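(* A complete list of inequivalent proper subalgebras of the complex rank-two affine Lie algebra $\mathfrak{aff}_2(\mathbb C)$ is given by 1D: $\mathfrak s_{1.1}=\langle f_1\rangle$, $\mathfrak s_{1.2}^{\delta}=\langle e_1+\delta f_1\rangle$, $\mathfrak s_{1.3}=\langle e_4\rangle$, $\mathfrak s_{1.4}^{\rho,\varphi}=\langle e_2+\rho e^{i\varphi}e_4\rangle$, $\mathfrak s_{1.5}=\langle e_2+e_4+f_2\rangle$, $\mathfrak s_{1.6}=\langle e_1+e_4\rangle$; 2D: $\mathfrak s_{2.1}=\langle f_1,f_2\rangle$, $\mathfrak s_{2.2}^{\delta}=\langle e_1+\delta f_1,f_2\rangle$, $\mathfrak s_{2.3}=\langle e_4,f_1\rangle$, $\mathfrak s_{2.4}^{\rho,\varphi}=\langle e_2+\rho e^{i\varphi}e_4,f_1\rangle$, $\mathfrak s_{2.5}^{\rho',\varphi}=\langle e_2+\rho'e^{i\varphi}e_4,f_2\rangle$, $\mathfrak s_{2.6}=\langle e_2+e_4+f_2,f_1\rangle$, $\mathfrak s_{2.7}=\langle e_1+e_4,f_2\rangle$, $\mathfrak s_{2.8}=\langle e_1,e_4\rangle$, $\mathfrak s_{2.9}=\langle e_2,e_4\rangle$, $\mathfrak s_{2.10}^\gamma=\langle e_2+\gamma e_4,e_1\rangle$, $\mathfrak s_{2.11}^\varepsilon=\langle e_2+\varepsilon e_4+f_2,e_1\rangle$, $\mathfrak s_{2.13}=\langle e_2-3e_4,e_1+f_1\rangle$; 3D: $\mathfrak s_{3.1}=\langle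 e_1,f_1,f_2\rangle$, $\mathfrak s_{3.2}=\langle e_4,f_1,f_2\rangle$, $\mathfrak s_{3.3}^{\rho,\varphi}=\langle e_2+\rho e^{i\varphi}e_4,f_1,f_2\rangle$, $\mathfrak s_{3.4}=\langle e_1+e_4,f_1,f_2\rangle$, $\mathfrak s_{3.5}=\langle e_1,e_4,f_2\rangle$, $\mathfrak s_{3.6}=\langle e_2,e_4,f_1\rangle$, $\mathfrak s_{3.7}^\gamma=\langle e_2+\gamma e_4,e_1,f_2\rangle$, $\mathfrak s_{3.8}=\langle e_2-e_4+f_1,e_1,f_2\rangle$, $\mathfrak s_{3.9}=\langle e_2-3e_4,e_1+f_1,f_2\rangle$, $\mathfrak s_{3.10}=\langle e_1,e_2,e_4\rangle$, $\mathfrak s_{3.11}=\langle e_1,e_2,e_3\rangle$; 4D: $\mathfrak s_{4.1}=\langle e_1,e_4,f_1,f_2\rangle$, $\mathfrak s_{4.2}=\langle e_2,e_4,f_1,f_2\rangle$, $\mathfrak s_{4.3}^\gamma=\langle e_2+\gamma e_4,e_1,f_1,f_2\rangle$, $\mathfrak s_{4.4}=\langle e_1,e_2,e_4,f_2\rangle$, $\mathfrak s_{4.5}=\langle e_1,e_2,e_3,e_4\rangle$; 5D: $\mathfrak s_{5.1}=\langle e_1,e_2,e_4,f_1,f_2\rangle$, $\mathfrak s_{5.2}=\langle e_1,e_2,e_3,f_1,f_2\rangle$; where $\varepsilon\in\{-1,1\}$, $\delta\in\{0,1\}$, $\rho\in\mathbb R_{\geqslant0}$, $\rho'\in\mathbb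 R_{>0}$, $-\pi/2<\varphi\leqslant\pi/2$ and $\gamma\in\mathbb C$.
   Context: $\mathfrak{aff}_2(\mathbb C)=\mathfrak{gl}_2(\mathbb C)\ltimes\mathbb C^2$, where $\mathfrak{gl}_2(\mathbb C)$ acts on the abelian Lie algebra $\mathbb C^2$ by matrix–vector multiplication, i.e. $[(A,v),(B,w)]=(AB-BA,\,Aw-Bv)$. The basis is $$e_1=\begin{pmatrix}0&0\\1&0\end{pmatrix},\ e_2=\tfrac12\begin{pmatrix}1&0\\0&-1\end{pmatrix},\ e_3=\begin{pmatrix}0&-1\\0&0\end{pmatrix},\ e_4=\tfrac12\begin{pmatrix}1&0\\0&1\end{pmatrix},\ f_1=\begin{pmatrix}1\\0\end{pmatrix},\ f_2=\begin{pmatrix}0\\1\end{pmatrix}.$$ $\langle\cdots\rangle$ denotes the complex linear span. Two subalgebras are equivalent if one is mapped onto the other by an inner automorphism of $\mathfrak{aff}_2(\mathbb C)$, i.e. by the adjoint action of an element of the connected group $\mathrm{GL}_2(\mathbb C)\ltimes\mathbb C^2$. "Proper" means different from $\{0\}$ and from the whole algebra. The families depending on $(\rho,\varphi)$ are indexed by the complex number $\rho e^{i\varphi}$, so that $\rho=0$ gives a single subalgebra regardless of $\varphi$.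
   Formalization: The list as stated has one repetition: s_{2.11} with ε=−1 is equivalent to s_{2.10} with γ=−1 (translate by (0,−1)). Inequivalence is asserted for all other pairs of distinct members; for this pair equivalence is asserted. *)

theory Defs
  imports "HOL-Analysis.Analysis"
begin

section \<open>The complex affine Lie algebra of rank two\<close>

text \<open>The pair \<open>(A, v)\<close> stands for the infinitesimal affine map \<open>x \<mapsto> A x + v\<close>. The library's
  unqualified \<open>span\<close>, \<open>subspace\<close> and \<open>dim\<close> are those of the underlying real vector space; the
  complex notions are the ones qualified by \<open>aff2\<close>.\<close>

type_synonym aff2 = "(complex^2^2) \<times> (complex^2)"

definition aff2_scale :: "complex \<Rightarrow> aff2 \<Rightarrow> aff2" (infixr "*\<^sub>a" 75)
  where "c *\<^sub>a X = ((\<chi> i j. c * fst X $ i $ j), c *s snd X)"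

global_interpretation aff2: vector_space aff2_scale
  by standard (simp_all add: aff2_scale_def vec_eq_iff prod_eq_iff algebra_simps)

definition aff2_bracket :: "aff2 \<Rightarrow> aff2 \<Rightarrow> aff2"
  where "aff2_bracket X Y =
    (fst X ** fst Y - fst Y ** fst X, fst X *v snd Y - fst Y *v snd X)"

definition aff2_subalgebra :: "aff2 set \<Rightarrow> bool"
  where "aff2_subalgebra S \<longleftrightarrow>
    aff2.subspace S \<and> (\<forall>X\<in>S. \<forall>Y\<in>S. aff2_bracket X Y \<in> S)"

definition proper_aff2_subalgebra :: "aff2 set \<Rightarrow> bool"
  where "proper_aff2_subalgebra S \<longleftrightarrow> aff2_subalgebra S \<and> S \<noteq> {0} \<and> S \<noteq> UNIV"

text \<open>Adjoint action of the element \<open>x \<mapsto> g x + u\<close> of the affine group. Writing this element as the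
  block matrix \<open>[[g, u], [0, 1]]\<close> and \<open>(A, v)\<close> as \<open>[[A, v], [0, 0]]\<close>, it is conjugation of the
  latter by the former.\<close>

definition aff2_Ad :: "complex^2^2 \<Rightarrow> complex^2 \<Rightarrow> aff2 \<Rightarrow> aff2"
  where "aff2_Ad g u X =
    (g ** fst X ** matrix_inv g, g *v snd X - (g ** fst X ** matrix_inv g) *v u)"

definition aff2_equiv :: "aff2 set \<Rightarrow> aff2 set \<Rightarrow> bool"
  where "aff2_equiv S T \<longleftrightarrow> (\<exists>g u. invertible g \<and> aff2_Ad g u ` S = T)"

section \<open>The list of subalgebras\<close>

definition e1 :: aff2 where "e1 = (vector [vector [0, 0], vector [1, 0]], 0)"
definition e2 :: aff2 where "e2 = (vector [vector [1/2, 0], vector [0, -1/2]], 0)"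
definition e3 :: aff2 where "e3 = (vector [vector [0, -1], vector [0, 0]], 0)"
definition e4 :: aff2 where "e4 = (vector [vector [1/2, 0], vector [0, 1/2]], 0)"
definition f1 :: aff2 where "f1 = (0, vector [1, 0])"
definition f2 :: aff2 where "f2 = (0, vector [0, 1])"

text \<open>The argument of \<open>S1_4\<close>, \<open>S2_4\<close>, \<open>S2_5\<close>, \<open>S3_3\<close> is the complex number \<open>\<rho> exp(i \<phi>)\<close>, so that
  \<open>\<rho> = 0\<close> gives a single label.\<close>

datatype aff2_label =
    S1_1 | S1_2 complex | S1_3 | S1_4 complex | S1_5 | S1_6
  | S2_1 | S2_2 complex | S2_3 | S2_4 complex | S2_5 complex | S2_6 | S2_7 | S2_8 | S2_9
  | S2_10 complex | S2_11 complex | S2_13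
  | S3_1 | S3_2 | S3_3 complex | S3_4 | S3_5 | S3_6 | S3_7 complex | S3_8 | S3_9 | S3_10 | S3_11
  | S4_1 | S4_2 | S4_3 complex | S4_4 | S4_5
  | S5_1 | S5_2

definition polar_params :: "real set \<Rightarrow> complex set"
  where "polar_params R =
    {of_real \<rho> * exp (\<i> * of_real \<phi>) | \<rho> \<phi>. \<rho> \<in> R \<and> - pi / 2 < \<phi> \<and> \<phi> \<le> pi / 2}"

fun admissible_label :: "aff2_label \<Rightarrow> bool" where
  "admissible_label (S1_2 \<delta>) \<longleftrightarrow> \<delta> \<in> {0, 1}"
| "admissible_label (S1_4 z) \<longleftrightarrow> z \<in> polar_params {0..}"
| "admissible_label (S2_2 \<delta>) \<longleftrightarrow> \<delta> \<in> {0, 1}"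
| "admissible_label (S2_4 z) \<longleftrightarrow> z \<in> polar_params {0..}"
| "admissible_label (S2_5 z) \<longleftrightarrow> z \<in> polar_params {0<..}"
| "admissible_label (S2_11 \<epsilon>) \<longleftrightarrow> \<epsilon> \<in> {-1, 1}"
| "admissible_label (S3_3 z) \<longleftrightarrow> z \<in> polar_params {0..}"
| "admissible_label _ \<longleftrightarrow> True"

fun label_generators :: "aff2_label \<Rightarrow> aff2 set" where
  "label_generators S1_1 = {f1}"
| "label_generators (S1_2 \<delta>) = {e1 + \<delta> *\<^sub>a f1}"
| "label_generators S1_3 = {e4}"
| "label_generators (S1_4 z) = {e2 + z *\<^sub>a e4}"
| "label_generators S1_5 = {e2 + e4 + f2}"
| "label_generators S1_6 = {e1 + e4}"
| "label_generators S2_1 = {f1, f2}"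
| "label_generators (S2_2 \<delta>) = {e1 + \<delta> *\<^sub>a f1, f2}"
| "label_generators S2_3 = {e4, f1}"
| "label_generators (S2_4 z) = {e2 + z *\<^sub>a e4, f1}"
| "label_generators (S2_5 z) = {e2 + z *\<^sub>a e4, f2}"
| "label_generators S2_6 = {e2 + e4 + f2, f1}"
| "label_generators S2_7 = {e1 + e4, f2}"
| "label_generators S2_8 = {e1, e4}"
| "label_generators S2_9 = {e2, e4}"
| "label_generators (S2_10 \<gamma>) = {e2 + \<gamma> *\<^sub>a e4, e1}"
| "label_generators (S2_11 \<epsilon>) = {e2 + \<epsilon> *\<^sub>a e4 + f2, e1}"
| "label_generators S2_13 = {e2 - 3 *\<^sub>a e4, e1 + f1}"
| "label_generators S3_1 = {e1, f1, f2}"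
| "label_generators S3_2 = {e4, f1, f2}"
| "label_generators (S3_3 z) = {e2 + z *\<^sub>a e4, f1, f2}"
| "label_generators S3_4 = {e1 + e4, f1, f2}"
| "label_generators S3_5 = {e1, e4, f2}"
| "label_generators S3_6 = {e2, e4, f1}"
| "label_generators (S3_7 \<gamma>) = {e2 + \<gamma> *\<^sub>a e4, e1, f2}"
| "label_generators S3_8 = {e2 - e4 + f1, e1, f2}"
| "label_generators S3_9 = {e2 - 3 *\<^sub>a e4, e1 + f1, f2}"
| "label_generators S3_10 = {e1, e2, e4}"
| "label_generators S3_11 = {e1, e2, e3}"
| "label_generators S4_1 = {e1, e4, f1, f2}"
| "label_generators S4_2 = {e2, e4, f1, f2}"
| "label_generators (S4_3 \<gamma>) = {e2 + \<gamma> *\<^sub>a e4, e1, f1, f2}"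
| "label_generators S4_4 = {e1, e2, e4, f2}"
| "label_generators S4_5 = {e1, e2, e3, e4}"
| "label_generators S5_1 = {e1, e2, e4, f1, f2}"
| "label_generators S5_2 = {e1, e2, e3, f1, f2}"

definition label_subalgebra :: "aff2_label \<Rightarrow> aff2 set"
  where "label_subalgebra L = aff2.span (label_generators L)"

fun label_dim :: "aff2_label \<Rightarrow> nat" where
  "label_dim S1_1 = 1" | "label_dim (S1_2 _) = 1" | "label_dim S1_3 = 1"
| "label_dim (S1_4 _) = 1" | "label_dim S1_5 = 1" | "label_dim S1_6 = 1"
| "label_dim S3_1 = 3" | "label_dim S3_2 = 3" | "label_dim (S3_3 _) = 3"
| "label_dim S3_4 = 3" | "label_dim S3_5 = 3" | "label_dim S3_6 = 3"
| "label_dim (S3_7 _) = 3" | "label_dim S3_8 = 3" | "label_dim S3_9 = 3"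
| "label_dim S3_10 = 3" | "label_dim S3_11 = 3"
| "label_dim S4_1 = 4" | "label_dim S4_2 = 4" | "label_dim (S4_3 _) = 4"
| "label_dim S4_4 = 4" | "label_dim S4_5 = 4"
| "label_dim S5_1 = 5" | "label_dim S5_2 = 5"
| "label_dim _ = 2"

text \<open>The list contains one repetition up to equivalence. The linear part of \<open>e2 - e4 + f2\<close> is
  \<open>diag(0, -1)\<close>, which maps \<open>(0, -1)\<close> to \<open>(0, 1)\<close>, while \<open>e1\<close> kills \<open>(0, -1)\<close>; hence the
  translation by \<open>(0, -1)\<close> carries \<open>\<langle>e2 - e4 + f2, e1\<rangle>\<close> onto \<open>\<langle>e2 - e4, e1\<rangle>\<close>.\<close>

lemma aff2_Ad_translation: "aff2_Ad (mat 1) u X = (fst X, snd X - fst X *v u)"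
proof -
  have "matrix_inv (mat 1 :: complex^2^2) = mat 1"
    unfolding matrix_inv_def by (rule some_equality) simp_all
  then show ?thesis by (simp add: aff2_Ad_def)
qed

lemma label_subalgebra_repetition:
  "aff2_equiv (label_subalgebra (S2_11 (-1))) (label_subalgebra (S2_10 (-1)))"
proof -
  let ?u = "vector [0, -1] :: complex^2"
  let ?T = "aff2_Ad (mat 1) ?u"
  have lin: "Vector_Spaces.linear aff2_scale aff2_scale ?T"
    by unfold_locales
      (simp_all add: aff2_Ad_translation aff2_scale_def prod_eq_iff vec_eq_iff
        matrix_vector_mult_def sum_2 algebra_simps)
  then interpret T: Vector_Spaces.linear aff2_scale aff2_scale ?T .
  have gen1: "?T (e2 + (-1) *\<^sub>a e4 + f2) = e2 + (-1) *\<^sub>a e4"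
    by (simp add: aff2_Ad_translation aff2_scale_def prod_eq_iff vec_eq_iff forall_2 sum_2
        matrix_vector_mult_def e2_def e4_def f2_def)
  have gen2: "?T e1 = e1"
    by (simp add: aff2_Ad_translation prod_eq_iff vec_eq_iff forall_2 sum_2
        matrix_vector_mult_def e1_def)
  have "?T ` label_subalgebra (S2_11 (-1)) = label_subalgebra (S2_10 (-1))"
    unfolding label_subalgebra_def T.span_image[symmetric]
    by (simp only: label_generators.simps image_insert image_empty gen1 gen2)
  moreover have "invertible (mat 1 :: complex^2^2)"
    by (auto simp: invertible_def)
  ultimately show ?thesis unfolding aff2_equiv_def by blast
qed

end

theory Submission
  imports Defs
begin

text \<open>Let S be a subalgebra, V the space of its translations; V is invariant under the linear part
  of S. The traceless part of the linear part is 0, a nilpotent line, a semisimple line, a Borel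
  subalgebra or the whole of sl(2), and it is brought to normal form by diagonalising an element
  with nonzero discriminant, or a nilpotent one if there is none. The scalars contribute either
  \<open>e4\<close> or a linear functional on the traceless part. Now V is 0, an invariant line or the whole
  plane, and S is determined up to translation by a class in the first cohomology of the linear
  part with values in the quotient of the plane by V. This class vanishes if \<open>e4\<close> is present;
  otherwise it lives in a space of dimension at most one and is scaled to 0 or 1.

  Inequivalence is read off from the dimension, from the presence of translations, nilpotents and
  homotheties, from the vanishing of the above class (a point fixed modulo V), and, for the
  continuous parameters, from the trace of an element normalised by its discriminant, by its
  eigenvalue on V, or by its action on the nilpotents.\<close>

section \<open>Coordinates and the adjoint action\<close>

text \<open>In the coordinates of the given basis \<open>x4\<close> is the trace and
  \<open>x2^2 - 4 * x1 * x3\<close> the discriminant of the linear part; conjugation, brackets and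
  cohomology all become explicit polynomial identities. The exceptional parameters are coincidences
  of weights. Under \<open>e2 + \<gamma> e4\<close> the vectors \<open>f1\<close>, \<open>f2\<close>
  have eigenvalues \<open>(\<gamma> + 1) / 2\<close>, \<open>(\<gamma> - 1) / 2\<close>, while
  \<open>[e2, e1] = - e1\<close>. A class can be nonzero only where weights match: a component of
  \<open>e2\<close> along \<open>f2\<close> at 1, of \<open>e2\<close> along \<open>f1\<close> at
  -1, of \<open>e1\<close> along \<open>f1\<close> at -3. The second violates the bracket relation
  with \<open>e1\<close> unless \<open>f2\<close> is a translation of \<open>S\<close>, so it shows
  up in \<open>S3_8\<close> but not in dimension two; a component of \<open>e1\<close> along
  \<open>f2\<close> fits at -1 as well but is removed by a translation. In the absence of
  \<open>e1\<close> the exchange of the axes turns -1 into 1, which leaves \<open>S1_5\<close> and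
  \<open>S2_6\<close>.\<close>

definition el :: "complex \<Rightarrow> complex \<Rightarrow> complex \<Rightarrow> complex \<Rightarrow> complex \<Rightarrow> complex \<Rightarrow> aff2"
  where "el x1 x2 x3 x4 y1 y2 =
    (vector [vector [(x2 + x4) / 2, - x3], vector [x1, (x4 - x2) / 2]], vector [y1, y2])"

lemma el_eq_iff [simp]:
  "el x1 x2 x3 x4 y1 y2 = el x1' x2' x3' x4' y1' y2' \<longleftrightarrow>
    x1 = x1' \<and> x2 = x2' \<and> x3 = x3' \<and> x4 = x4' \<and> y1 = y1' \<and> y2 = y2'"
proof -
  have "x2 = x2' \<and> x4 = x4'"
    if "(x2 + x4) / 2 = (x2' + x4') / 2" "(x4 - x2) / 2 = (x4' - x2') / 2"
    using that by (simp add: complex_eq_iff)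
  then show ?thesis
    by (auto simp: el_def vec_eq_iff forall_2 simp del: divide_eq_eq_numeral1 eq_divide_eq_numeral1)
qed

lemma el_zero: "0 = el 0 0 0 0 0 0"
  by (simp add: el_def vec_eq_iff forall_2 prod_eq_iff)

lemma el_add: "el x1 x2 x3 x4 y1 y2 + el x1' x2' x3' x4' y1' y2' =
    el (x1 + x1') (x2 + x2') (x3 + x3') (x4 + x4') (y1 + y1') (y2 + y2')"
  by (simp add: el_def vec_eq_iff forall_2 prod_eq_iff field_simps)

lemma el_diff: "el x1 x2 x3 x4 y1 y2 - el x1' x2' x3' x4' y1' y2' =
    el (x1 - x1') (x2 - x2') (x3 - x3') (x4 - x4') (y1 - y1') (y2 - y2')"
  by (simp add: el_def vec_eq_iff forall_2 prod_eq_iff field_simps)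

lemma el_scale: "c *\<^sub>a el x1 x2 x3 x4 y1 y2 =
    el (c * x1) (c * x2) (c * x3) (c * x4) (c * y1) (c * y2)"
  by (simp add: el_def aff2_scale_def vec_eq_iff forall_2 prod_eq_iff field_simps)

lemma aff2_exhaust [case_names el]:
  obtains x1 x2 x3 x4 y1 y2 where "X = el x1 x2 x3 x4 y1 y2"
proof -
  have "X = el (fst X $ 2 $ 1) (fst X $ 1 $ 1 - fst X $ 2 $ 2) (- fst X $ 1 $ 2)
      (fst X $ 1 $ 1 + fst X $ 2 $ 2) (snd X $ 1) (snd X $ 2)"
    by (simp add: el_def vec_eq_iff forall_2 prod_eq_iff)
  then show ?thesis by (rule that)
qed

lemma basis_el:
  "e1 = el 1 0 0 0 0 0" "e2 = el 0 1 0 0 0 0" "e3 = el 0 0 1 0 0 0"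
  "e4 = el 0 0 0 1 0 0" "f1 = el 0 0 0 0 1 0" "f2 = el 0 0 0 0 0 1"
  by (simp_all add: el_def e1_def e2_def e3_def e4_def f1_def f2_def vec_eq_iff forall_2 prod_eq_iff)

lemma bracket_el:
  "aff2_bracket (el x1 x2 x3 x4 y1 y2) (el x1' x2' x3' x4' y1' y2') =
    el (x1 * x2' - x2 * x1') (2 * (x1 * x3' - x3 * x1')) (x2 * x3' - x3 * x2') 0
      ((x2 + x4) / 2 * y1' - x3 * y2' - ((x2' + x4') / 2 * y1 - x3' * y2))
      (x1 * y1' + (x4 - x2) / 2 * y2' - (x1' * y1 + (x4' - x2') / 2 * y2))"
  by (simp add: el_def aff2_bracket_def vec_eq_iff forall_2 prod_eq_iff sum_2
      matrix_matrix_mult_def matrix_vector_mult_def field_simps)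

definition mat2 :: "complex \<Rightarrow> complex \<Rightarrow> complex \<Rightarrow> complex \<Rightarrow> complex^2^2"
  where "mat2 p q r s = vector [vector [p, q], vector [r, s]]"

lemma invertible_mat2: "invertible (mat2 p q r s) \<longleftrightarrow> p * s - q * r \<noteq> 0"
  by (simp add: invertible_det_nz det_2 mat2_def)

lemma matrix_inv_mult:
  fixes g :: "'a::semiring_1^'n^'m"
  assumes "invertible g"
  shows "g ** matrix_inv g = mat 1" "matrix_inv g ** g = mat 1"
  using someI_ex[OF assms[unfolded invertible_def]] by (simp_all add: matrix_inv_def)

text \<open>Multiplying by \<open>g\<close> on the right clears the inverse from the conjugation, so
  that \<open>matrix_inv\<close> never has to be computed.\<close>

lemma aff2_Ad_eqI:
  assumes "invertible g" "g ** fst X = fst Y ** g" "snd Y = g *v snd X - fst Y *v u"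
  shows "aff2_Ad g u X = Y"
proof -
  have "g ** fst X ** matrix_inv g = fst Y"
    using assms(1,2) by (metis matrix_inv_mult(1) matrix_mul_assoc matrix_mul_rid)
  then show ?thesis using assms(3) by (simp add: aff2_Ad_def prod_eq_iff)
qed

text \<open>The inverse matrix is the adjugate divided by \<open>D\<close>, so the coefficients of
  the new coordinates are quadratic in \<open>p, q, r, s\<close>. The trace \<open>x4\<close> is
  untouched.\<close>

lemma aff2_Ad_el:
  fixes p q r s :: complex
  defines "D \<equiv> p * s - q * r"
  defines "X1 x1 x2 x3 \<equiv> (s\<^sup>2 * x1 + r * s * x2 + r\<^sup>2 * x3) / D"
  defines "X2 x1 x2 x3 \<equiv> (2 * q * s * x1 + (p * s + q * r) * x2 + 2 * p * r * x3) / D"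
  defines "X3 x1 x2 x3 \<equiv> (q\<^sup>2 * x1 + p * q * x2 + p\<^sup>2 * x3) / D"
  assumes "D \<noteq> 0"
  shows "aff2_Ad (mat2 p q r s) (vector [u1, u2]) (el x1 x2 x3 x4 y1 y2) =
    el (X1 x1 x2 x3) (X2 x1 x2 x3) (X3 x1 x2 x3) x4
     (p * y1 + q * y2 - ((X2 x1 x2 x3 + x4) / 2 * u1 - X3 x1 x2 x3 * u2))
     (r * y1 + s * y2 - (X1 x1 x2 x3 * u1 + (x4 - X2 x1 x2 x3) / 2 * u2))"
proof (rule aff2_Ad_eqI)
  show "invertible (mat2 p q r s)" using assms(5) by (simp add: invertible_mat2 D_def)
next
  show "mat2 p q r s ** fst (el x1 x2 x3 x4 y1 y2) = fst (el (X1 x1 x2 x3) (X2 x1 x2 x3) (X3 x1 x2 x3) x4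
     (p * y1 + q * y2 - ((X2 x1 x2 x3 + x4) / 2 * u1 - X3 x1 x2 x3 * u2))
     (r * y1 + s * y2 - (X1 x1 x2 x3 * u1 + (x4 - X2 x1 x2 x3) / 2 * u2))) ** mat2 p q r s"
    using assms(5)
    by (simp add: el_def mat2_def vec_eq_iff forall_2 sum_2 X1_def X2_def X3_def
        matrix_matrix_mult_def divide_simps)
      (simp add: D_def algebra_simps power2_eq_square)
qed (simp_all add: el_def mat2_def vec_eq_iff forall_2 sum_2 matrix_vector_mult_def)

text \<open>This is the composition law of the affine maps \<open>x \<mapsto> g x + u\<close> and
  \<open>x \<mapsto> h x + v\<close>; transitivity and symmetry of the equivalence rest on
  it.\<close>

lemma aff2_Ad_comp:
  assumes g: "invertible g" and h: "invertible h"
  shows "aff2_Ad g u (aff2_Ad h v X) = aff2_Ad (g ** h) (g *v v + u) X"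
proof (rule sym, rule aff2_Ad_eqI)
  show "invertible (g ** h)" using g h by (rule invertible_mult)
  let ?B = "h ** fst X ** matrix_inv h"
  have B: "?B ** h = h ** fst X"
    by (simp add: matrix_mul_assoc[symmetric] matrix_inv_mult[OF h])
  have C: "g ** ?B ** matrix_inv g ** g = g ** ?B"
    by (simp add: matrix_mul_assoc[symmetric] matrix_inv_mult[OF g])
  have "g ** ?B ** matrix_inv g ** (g ** h) = g ** ?B ** h"
    by (simp only: matrix_mul_assoc C[unfolded matrix_mul_assoc])
  also have "\<dots> = g ** h ** fst X"
    by (simp only: matrix_mul_assoc[symmetric] B[unfolded matrix_mul_assoc[symmetric]])
  finally show "g ** h ** fst X = fst (aff2_Ad g u (aff2_Ad h v X)) ** (g ** h)"
    by (simp add: aff2_Ad_def)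
  have "(g ** ?B ** matrix_inv g) *v (g *v v) = g *v (?B *v v)"
    by (simp only: matrix_vector_mul_assoc C)
  then show "snd (aff2_Ad g u (aff2_Ad h v X)) =
      (g ** h) *v snd X - fst (aff2_Ad g u (aff2_Ad h v X)) *v (g *v v + u)"
    by (simp add: aff2_Ad_def matrix_vector_mul_assoc[symmetric] matrix_vector_right_distrib
        matrix_vector_mult_diff_distrib)
qed

lemma aff2_equiv_refl: "aff2_equiv S S"
proof -
  have "aff2_Ad (mat 1) 0 ` S = S"
    by (simp add: aff2_Ad_translation)
  then show ?thesis
    unfolding aff2_equiv_def by (auto simp: invertible_def intro!: exI[of _ "mat 1"])
qed

lemma aff2_equiv_trans:
  assumes "aff2_equiv S T" "aff2_equiv T U" shows "aff2_equiv S U"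
proof -
  obtain g u h v where "invertible g" "invertible h" "U = aff2_Ad g u ` aff2_Ad h v ` S"
    using assms unfolding aff2_equiv_def by metis
  then have "aff2_Ad (g ** h) (g *v v + u) ` S = U" "invertible (g ** h)"
    by (simp_all add: image_image aff2_Ad_comp invertible_mult)
  then show ?thesis unfolding aff2_equiv_def by blast
qed

lemma aff2_equiv_sym:
  assumes "aff2_equiv S T" shows "aff2_equiv T S"
proof -
  obtain g u where g: "invertible g" and T: "T = aff2_Ad g u ` S"
    using assms unfolding aff2_equiv_def by metis
  let ?h = "matrix_inv g"
  have h: "invertible ?h"
    using matrix_inv_mult[OF g] by (auto simp: invertible_def)
  have "aff2_Ad ?h (- (?h *v u)) ` T = S"
    using matrix_inv_mult(2)[OF g] by (simp add: T image_image aff2_Ad_comp g h aff2_Ad_translation)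
  then show ?thesis using h unfolding aff2_equiv_def by blast
qed

lemma mem_span_insert:
  "X \<in> aff2.span (insert a G) \<longleftrightarrow> (\<exists>k. X - k *\<^sub>a a \<in> aff2.span G)"
  by (simp add: aff2.span_breakdown_eq)

lemmas el_simps = el_add el_diff el_scale basis_el el_zero

section \<open>The listed subalgebras\<close>

lemma label_subalgebra_iff:
  "el x1 x2 x3 x4 y1 y2 \<in> label_subalgebra S1_1 \<longleftrightarrow>
    x1 = 0 \<and> x2 = 0 \<and> x3 = 0 \<and> x4 = 0 \<and> y2 = 0"
  "el x1 x2 x3 x4 y1 y2 \<in> label_subalgebra (S1_2 \<delta>) \<longleftrightarrow>
    x2 = 0 \<and> x3 = 0 \<and> x4 = 0 \<and> y1 = \<delta> * x1 \<and> y2 = 0"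
  "el x1 x2 x3 x4 y1 y2 \<in> label_subalgebra S1_3 \<longleftrightarrow>
    x1 = 0 \<and> x2 = 0 \<and> x3 = 0 \<and> y1 = 0 \<and> y2 = 0"
  "el x1 x2 x3 x4 y1 y2 \<in> label_subalgebra (S1_4 z) \<longleftrightarrow>
    x1 = 0 \<and> x3 = 0 \<and> x4 = z * x2 \<and> y1 = 0 \<and> y2 = 0"
  "el x1 x2 x3 x4 y1 y2 \<in> label_subalgebra S1_5 \<longleftrightarrow>
    x1 = 0 \<and> x3 = 0 \<and> x4 = x2 \<and> y1 = 0 \<and> y2 = x2"
  "el x1 x2 x3 x4 y1 y2 \<in> label_subalgebra S1_6 \<longleftrightarrow>
    x2 = 0 \<and> x3 = 0 \<and> x4 = x1 \<and> y1 = 0 \<and> y2 = 0"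
  "el x1 x2 x3 x4 y1 y2 \<in> label_subalgebra S2_1 \<longleftrightarrow>
    x1 = 0 \<and> x2 = 0 \<and> x3 = 0 \<and> x4 = 0"
  "el x1 x2 x3 x4 y1 y2 \<in> label_subalgebra (S2_2 \<delta>) \<longleftrightarrow>
    x2 = 0 \<and> x3 = 0 \<and> x4 = 0 \<and> y1 = \<delta> * x1"
  "el x1 x2 x3 x4 y1 y2 \<in> label_subalgebra S2_3 \<longleftrightarrow>
    x1 = 0 \<and> x2 = 0 \<and> x3 = 0 \<and> y2 = 0"
  "el x1 x2 x3 x4 y1 y2 \<in> label_subalgebra (S2_4 z) \<longleftrightarrow>
    x1 = 0 \<and> x3 = 0 \<and> x4 = z * x2 \<and> y2 = 0"
  "el x1 x2 x3 x4 y1 y2 \<in> label_subalgebra (S2_5 z) \<longleftrightarrow>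
    x1 = 0 \<and> x3 = 0 \<and> x4 = z * x2 \<and> y1 = 0"
  "el x1 x2 x3 x4 y1 y2 \<in> label_subalgebra S2_6 \<longleftrightarrow>
    x1 = 0 \<and> x3 = 0 \<and> x4 = x2 \<and> y2 = x2"
  "el x1 x2 x3 x4 y1 y2 \<in> label_subalgebra S2_7 \<longleftrightarrow>
    x2 = 0 \<and> x3 = 0 \<and> x4 = x1 \<and> y1 = 0"
  "el x1 x2 x3 x4 y1 y2 \<in> label_subalgebra S2_8 \<longleftrightarrow>
    x2 = 0 \<and> x3 = 0 \<and> y1 = 0 \<and> y2 = 0"
  "el x1 x2 x3 x4 y1 y2 \<in> label_subalgebra S2_9 \<longleftrightarrow>
    x1 = 0 \<and> x3 = 0 \<and> y1 = 0 \<and> y2 = 0"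
  "el x1 x2 x3 x4 y1 y2 \<in> label_subalgebra (S2_10 \<gamma>) \<longleftrightarrow>
    x3 = 0 \<and> x4 = \<gamma> * x2 \<and> y1 = 0 \<and> y2 = 0"
  "el x1 x2 x3 x4 y1 y2 \<in> label_subalgebra (S2_11 \<epsilon>) \<longleftrightarrow>
    x3 = 0 \<and> x4 = \<epsilon> * x2 \<and> y1 = 0 \<and> y2 = x2"
  "el x1 x2 x3 x4 y1 y2 \<in> label_subalgebra S2_13 \<longleftrightarrow>
    x3 = 0 \<and> x4 = - 3 * x2 \<and> y1 = x1 \<and> y2 = 0"
  "el x1 x2 x3 x4 y1 y2 \<in> label_subalgebra S3_1 \<longleftrightarrow>
    x2 = 0 \<and> x3 = 0 \<and> x4 = 0"
  "el x1 x2 x3 x4 y1 y2 \<in> label_subalgebra S3_2 \<longleftrightarrow>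
    x1 = 0 \<and> x2 = 0 \<and> x3 = 0"
  "el x1 x2 x3 x4 y1 y2 \<in> label_subalgebra (S3_3 z) \<longleftrightarrow>
    x1 = 0 \<and> x3 = 0 \<and> x4 = z * x2"
  "el x1 x2 x3 x4 y1 y2 \<in> label_subalgebra S3_4 \<longleftrightarrow>
    x2 = 0 \<and> x3 = 0 \<and> x4 = x1"
  "el x1 x2 x3 x4 y1 y2 \<in> label_subalgebra S3_5 \<longleftrightarrow>
    x2 = 0 \<and> x3 = 0 \<and> y1 = 0"
  "el x1 x2 x3 x4 y1 y2 \<in> label_subalgebra S3_6 \<longleftrightarrow>
    x1 = 0 \<and> x3 = 0 \<and> y2 = 0"
  "el x1 x2 x3 x4 y1 y2 \<in> label_subalgebra (S3_7 \<gamma>) \<longleftrightarrow>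
    x3 = 0 \<and> x4 = \<gamma> * x2 \<and> y1 = 0"
  "el x1 x2 x3 x4 y1 y2 \<in> label_subalgebra S3_8 \<longleftrightarrow>
    x3 = 0 \<and> x4 = - x2 \<and> y1 = x2"
  "el x1 x2 x3 x4 y1 y2 \<in> label_subalgebra S3_9 \<longleftrightarrow>
    x3 = 0 \<and> x4 = - 3 * x2 \<and> y1 = x1"
  "el x1 x2 x3 x4 y1 y2 \<in> label_subalgebra S3_10 \<longleftrightarrow>
    x3 = 0 \<and> y1 = 0 \<and> y2 = 0"
  "el x1 x2 x3 x4 y1 y2 \<in> label_subalgebra S3_11 \<longleftrightarrow>
    x4 = 0 \<and> y1 = 0 \<and> y2 = 0"
  "el x1 x2 x3 x4 y1 y2 \<in> label_subalgebra S4_1 \<longleftrightarrow>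
    x2 = 0 \<and> x3 = 0"
  "el x1 x2 x3 x4 y1 y2 \<in> label_subalgebra S4_2 \<longleftrightarrow>
    x1 = 0 \<and> x3 = 0"
  "el x1 x2 x3 x4 y1 y2 \<in> label_subalgebra (S4_3 \<gamma>) \<longleftrightarrow>
    x3 = 0 \<and> x4 = \<gamma> * x2"
  "el x1 x2 x3 x4 y1 y2 \<in> label_subalgebra S4_4 \<longleftrightarrow>
    x3 = 0 \<and> y1 = 0"
  "el x1 x2 x3 x4 y1 y2 \<in> label_subalgebra S4_5 \<longleftrightarrow>
    y1 = 0 \<and> y2 = 0"
  "el x1 x2 x3 x4 y1 y2 \<in> label_subalgebra S5_1 \<longleftrightarrow>
    x3 = 0"
  "el x1 x2 x3 x4 y1 y2 \<in> label_subalgebra S5_2 \<longleftrightarrow>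
    x4 = 0"
  by (auto simp: label_subalgebra_def mem_span_insert el_simps)
    (simp_all add: eq_neg_iff_add_eq_0 mult.commute)

lemma subspace_label: "aff2.subspace (label_subalgebra L)"
  by (simp add: label_subalgebra_def)

lemma all_in_el: "(\<forall>X\<in>S. P X) \<longleftrightarrow>
   (\<forall>x1 x2 x3 x4 y1 y2. el x1 x2 x3 x4 y1 y2 \<in> S \<longrightarrow> P (el x1 x2 x3 x4 y1 y2))"
  by (metis aff2_exhaust)

lemma bracket_closed_label:
  assumes "el x1 x2 x3 x4 y1 y2 \<in> label_subalgebra L" "el x1' x2' x3' x4' y1' y2' \<in> label_subalgebra L"
  shows "aff2_bracket (el x1 x2 x3 x4 y1 y2) (el x1' x2' x3' x4' y1' y2') \<in> label_subalgebra L"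
  using assms unfolding bracket_el
  by (cases L) (auto simp: label_subalgebra_iff field_simps)

lemma aff2_subalgebra_label: "aff2_subalgebra (label_subalgebra L)"
  by (simp add: aff2_subalgebra_def all_in_el bracket_closed_label subspace_label)

lemma dim_label: "aff2.dim (label_subalgebra L) = label_dim L"
proof -
  have "aff2.independent (label_generators L) \<and> card (label_generators L) = label_dim L"
    by (cases L) (auto simp: aff2.independent_insert mem_span_insert el_simps)
  then show ?thesis
    by (simp add: label_subalgebra_def aff2.dim_eq_card_independent)
qed

lemma proper_label: "proper_aff2_subalgebra (label_subalgebra L)"
proof -
  have "label_dim L \<noteq> 0" by (cases L) auto
  then have "label_subalgebra L \<noteq> {0}"
    using dim_label[of L] aff2.dim_eq_card_independent[OF aff2.independent_empty]
    by (metis aff2.dim_span aff2.span_empty card.empty)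
  \<comment> \<open>Only \<open>S3_11\<close>, \<open>S4_5\<close> and \<open>S5_2\<close> contain
    \<open>e3\<close>, and each of them misses \<open>e4\<close> or \<open>f1\<close>.\<close>
  moreover have "el 0 0 1 0 0 0 \<notin> label_subalgebra L \<or> el 0 0 0 1 0 0 \<notin> label_subalgebra L \<or>
      el 0 0 0 0 1 0 \<notin> label_subalgebra L"
    by (cases L) (auto simp: label_subalgebra_iff)
  ultimately show ?thesis
    unfolding proper_aff2_subalgebra_def using aff2_subalgebra_label by blast
qed

section \<open>Compatibility of the adjoint action with the Lie structure\<close>

lemma matrix_add_rdistrib: "((A :: 'a::semiring_1^'n^'m) + B) ** C = A ** C + B ** C"
  by (simp add: matrix_matrix_mult_def vec_eq_iff distrib_right sum.distrib)

lemma matrix_diff_ldistrib: "(A :: 'a::ring_1^'n^'m) ** (B - C) = A ** B - A ** C"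
  by (simp add: matrix_matrix_mult_def vec_eq_iff right_diff_distrib sum_subtractf)

lemma matrix_diff_rdistrib: "((A :: 'a::ring_1^'n^'m) - B) ** C = A ** C - B ** C"
  by (simp add: matrix_matrix_mult_def vec_eq_iff left_diff_distrib sum_subtractf)

lemma aff2_Ad_add: "aff2_Ad g u (X + Y) = aff2_Ad g u X + aff2_Ad g u Y"
  by (simp add: aff2_Ad_def matrix_add_ldistrib matrix_add_rdistrib
      matrix_vector_mult_add_rdistrib matrix_vector_right_distrib)

lemma aff2_Ad_scale: "aff2_Ad g u (c *\<^sub>a X) = c *\<^sub>a aff2_Ad g u X"
  by (simp add: aff2_Ad_def aff2_scale_def vec_eq_iff matrix_matrix_mult_def
      matrix_vector_mult_def sum_distrib_left sum_distrib_right sum_subtractf algebra_simps)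

lemma linear_aff2_Ad: "Vector_Spaces.linear aff2_scale aff2_scale (aff2_Ad g u)"
  by unfold_locales (simp_all add: aff2_Ad_add aff2_Ad_scale)

lemma aff2_Ad_bracket:
  assumes "invertible g"
  shows "aff2_Ad g u (aff2_bracket X Y) = aff2_bracket (aff2_Ad g u X) (aff2_Ad g u Y)"
proof -
  have "A ** matrix_inv g ** g = A" for A :: "complex^2^2"
    using matrix_inv_mult(2)[OF assms] by (simp add: matrix_mul_assoc[symmetric])
  then show ?thesis
    by (simp add: aff2_Ad_def aff2_bracket_def matrix_diff_ldistrib matrix_diff_rdistrib
        matrix_mul_assoc matrix_vector_mult_diff_distrib matrix_vector_mult_diff_rdistrib
        matrix_vector_mul_assoc)
qed

lemma aff2_Ad_inverse:
  assumes "invertible g" shows "aff2_Ad g u (aff2_Ad (matrix_inv g) (- (matrix_inv g *v u)) X) = X"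
proof -
  have "invertible (matrix_inv g)"
    using matrix_inv_mult[OF assms] by (auto simp: invertible_def)
  moreover have "g *v - (matrix_inv g *v u) = - u"
    using matrix_inv_mult(1)[OF assms]
    by (simp add: vec.neg matrix_vector_mul_assoc)
  ultimately show ?thesis
    using assms matrix_inv_mult(1)[OF assms] by (simp add: aff2_Ad_comp aff2_Ad_translation)
qed

lemma surj_aff2_Ad: "invertible g \<Longrightarrow> surj (aff2_Ad g u)"
  by (rule surjI) (rule aff2_Ad_inverse)

definition classified :: "aff2 set \<Rightarrow> bool"
  where "classified S \<longleftrightarrow> S = {0} \<or> S = UNIV \<or>
    (\<exists>L. admissible_label L \<and> aff2_equiv S (label_subalgebra L))"

text \<open>Preimages rather than images: membership in a transformed set is then a substitution
  instance of membership in the original one.\<close>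

definition pullback :: "complex^2^2 \<Rightarrow> complex^2 \<Rightarrow> aff2 set \<Rightarrow> aff2 set"
  where "pullback g u S = aff2_Ad g u -` S"

lemma classified_pullback:
  assumes g: "invertible g" and c: "classified (pullback g u S)"
  shows "classified S"
proof -
  let ?S = "pullback g u S"
  have im: "aff2_Ad g u ` ?S = S"
    using surj_image_vimage_eq[OF surj_aff2_Ad[OF g]] by (simp add: pullback_def)
  then have eq: "aff2_equiv S ?S"
    using g aff2_equiv_sym unfolding aff2_equiv_def by blast
  have "aff2_Ad g u 0 = 0" by (simp add: aff2_Ad_def zero_prod_def)
  then have "S = {0}" if "?S = {0}" using im that by auto
  moreover have "S = UNIV" if "?S = UNIV"
    using that im surj_aff2_Ad[OF g] by metis
  ultimately show ?thesis
    using c eq aff2_equiv_trans unfolding classified_def by blast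
qed

lemma aff2_subalgebra_pullback:
  assumes "invertible g" "aff2_subalgebra S"
  shows "aff2_subalgebra (pullback g u S)"
proof -
  have "aff2_Ad g u 0 = 0" by (simp add: aff2_Ad_def zero_prod_def)
  then show ?thesis
    using assms by (simp add: pullback_def aff2_subalgebra_def aff2.subspace_def aff2_Ad_add
        aff2_Ad_scale aff2_Ad_bracket)
qed

section \<open>Base changes and translations in coordinates\<close>

abbreviation transformed :: "complex \<Rightarrow> complex \<Rightarrow> complex \<Rightarrow> complex \<Rightarrow> aff2 set \<Rightarrow> aff2 set"
  where "transformed p q r s \<equiv> pullback (mat2 p q r s) (vector [0, 0])"

abbreviation translated :: "complex \<Rightarrow> complex \<Rightarrow> aff2 set \<Rightarrow> aff2 set"
  where "translated u1 u2 \<equiv> pullback (mat2 1 0 0 1) (vector [u1, u2])"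

lemma transformed:
  assumes "p * s - q * r \<noteq> 0"
  shows "aff2_subalgebra S \<Longrightarrow> aff2_subalgebra (transformed p q r s S)"
    and "classified (transformed p q r s S) \<Longrightarrow> classified S"
    and "el x1 x2 x3 x4 y1 y2 \<in> transformed p q r s S \<longleftrightarrow>
      el ((s\<^sup>2 * x1 + r * s * x2 + r\<^sup>2 * x3) / (p * s - q * r))
        ((2 * q * s * x1 + (p * s + q * r) * x2 + 2 * p * r * x3) / (p * s - q * r))
        ((q\<^sup>2 * x1 + p * q * x2 + p\<^sup>2 * x3) / (p * s - q * r))
        x4 (p * y1 + q * y2) (r * y1 + s * y2) \<in> S"
  using assms classified_pullback[of "mat2 p q r s" "vector [0, 0]" S]
    aff2_subalgebra_pullback[of "mat2 p q r s" S "vector [0, 0]"]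
  by (auto simp: invertible_mat2 aff2_Ad_el pullback_def)

text \<open>Diagonal matrices keep \<open>e2\<close> and \<open>e4\<close> and rescale
  \<open>e1\<close>, \<open>e3\<close>. Those with \<open>p = q\<close> fix the whole linear part
  and multiply translations by a constant, which is how a nonzero class is scaled to 1.\<close>

lemma scaled:
  assumes "p \<noteq> 0" "q \<noteq> 0"
  shows "aff2_subalgebra S \<Longrightarrow> aff2_subalgebra (transformed p 0 0 q S)"
    and "classified (transformed p 0 0 q S) \<Longrightarrow> classified S"
    and "el x1 x2 x3 x4 y1 y2 \<in> transformed p 0 0 q S \<longleftrightarrow>
      el (q / p * x1) x2 (p / q * x3) x4 (p * y1) (q * y2) \<in> S"
  using assms transformed[of p q 0 0] by (auto simp: power2_eq_square)

text \<open>The exchange of the two axes is the Weyl group element: it negates \<open>e2\<close> and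
  exchanges the lines of \<open>e1\<close> and \<open>e3\<close>. Hence it also changes the sign of
  the parameter in \<open>e2 + z e4\<close>.\<close>

lemma swapped:
  shows "aff2_subalgebra S \<Longrightarrow> aff2_subalgebra (transformed 0 1 1 0 S)"
    and "classified (transformed 0 1 1 0 S) \<Longrightarrow> classified S"
    and "el x1 x2 x3 x4 y1 y2 \<in> transformed 0 1 1 0 S \<longleftrightarrow>
      el (- x3) (- x2) (- x1) x4 y2 y1 \<in> S"
  using transformed[of 0 0 1 1] by auto

text \<open>The linear part stays fixed and the translation part changes by the coboundary of
  \<open>(u1, u2)\<close>.\<close>

lemma translated:
  shows "aff2_subalgebra S \<Longrightarrow> aff2_subalgebra (translated u1 u2 S)"
    and "classified (translated u1 u2 S) \<Longrightarrow> classified S"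
    and mem_translated: "el x1 x2 x3 x4 y1 y2 \<in> translated u1 u2 S \<longleftrightarrow>
      el x1 x2 x3 x4 (y1 - ((x2 + x4) / 2 * u1 - x3 * u2))
        (y2 - (x1 * u1 + (x4 - x2) / 2 * u2)) \<in> S"
  using classified_pullback[of "mat2 1 0 0 1" "vector [u1, u2]" S]
    aff2_subalgebra_pullback[of "mat2 1 0 0 1" S "vector [u1, u2]"]
  by (auto simp: invertible_mat2 aff2_Ad_el pullback_def)

lemma
  assumes "aff2_subalgebra S"
  shows subalgebra_zero: "el 0 0 0 0 0 0 \<in> S"
  and subalgebra_add: "el x1 x2 x3 x4 y1 y2 \<in> S \<Longrightarrow> el x1' x2' x3' x4' y1' y2' \<in> S \<Longrightarrow>
    el (x1 + x1') (x2 + x2') (x3 + x3') (x4 + x4') (y1 + y1') (y2 + y2') \<in> S"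
  and subalgebra_diff: "el x1 x2 x3 x4 y1 y2 \<in> S \<Longrightarrow> el x1' x2' x3' x4' y1' y2' \<in> S \<Longrightarrow>
    el (x1 - x1') (x2 - x2') (x3 - x3') (x4 - x4') (y1 - y1') (y2 - y2') \<in> S"
  and subalgebra_scale: "el x1 x2 x3 x4 y1 y2 \<in> S \<Longrightarrow>
    el (c * x1) (c * x2) (c * x3) (c * x4) (c * y1) (c * y2) \<in> S"
  and subalgebra_bracket: "el x1 x2 x3 x4 y1 y2 \<in> S \<Longrightarrow> el x1' x2' x3' x4' y1' y2' \<in> S \<Longrightarrow>
    el (x1 * x2' - x2 * x1') (2 * (x1 * x3' - x3 * x1')) (x2 * x3' - x3 * x2') 0
      ((x2 + x4) / 2 * y1' - x3 * y2' - ((x2' + x4') / 2 * y1 - x3' * y2))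
      (x1 * y1' + (x4 - x2) / 2 * y2' - (x1' * y1 + (x4' - x2') / 2 * y2)) \<in> S"
  using assms
  by (simp_all only: el_zero[symmetric] el_add[symmetric] el_diff[symmetric] el_scale[symmetric]
      bracket_el[symmetric] aff2_subalgebra_def aff2.subspace_0 aff2.subspace_add
      aff2.subspace_diff aff2.subspace_scale)

lemma translations_cases [consumes 1, case_names none all line]:
  assumes "aff2_subalgebra S"
  obtains "\<And>y1 y2. el 0 0 0 0 y1 y2 \<in> S \<longleftrightarrow> y1 = 0 \<and> y2 = 0"
  | "\<And>y1 y2. el 0 0 0 0 y1 y2 \<in> S"
  | a b where "a \<noteq> 0 \<or> b \<noteq> 0" "\<And>y1 y2. el 0 0 0 0 y1 y2 \<in> S \<longleftrightarrow> a * y2 = b * y1"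
proof (cases "\<exists>a b. el 0 0 0 0 a b \<in> S \<and> (a \<noteq> 0 \<or> b \<noteq> 0)")
  case False
  then show thesis using that(1) subalgebra_zero[OF assms] by blast
next
  case True
  then obtain a b where ab: "el 0 0 0 0 a b \<in> S" "a \<noteq> 0 \<or> b \<noteq> 0" by blast
  have "el 0 0 0 0 y1 y2 \<in> S" if "a * y2 = b * y1" for y1 y2
  proof (cases "a = 0")
    case True
    then show ?thesis using that ab subalgebra_scale[OF assms ab(1), of "y2 / b"] by simp
  next
    case False
    then have "y2 = y1 / a * b" using that by (simp add: field_simps)
    then show ?thesis
      using False subalgebra_scale[OF assms ab(1), of "y1 / a"] by simp
  qed
  moreover have "el 0 0 0 0 y1 y2 \<in> S"
    if "el 0 0 0 0 c d \<in> S" "a * d \<noteq> b * c" for c d y1 y2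
  proof -
    let ?D = "a * d - b * c"
    have "el 0 0 0 0 (s * a + t * c) (s * b + t * d) \<in> S" for s t
      using subalgebra_add[OF assms subalgebra_scale[OF assms ab(1)]
          subalgebra_scale[OF assms that(1)], of s t] by simp
    \<comment> \<open>Cramer's rule for writing \<open>(y1, y2)\<close> as a combination of
      \<open>(a, b)\<close> and \<open>(c, d)\<close>.\<close>
    note this[of "(d * y1 - c * y2) / ?D" "(a * y2 - b * y1) / ?D"]
    moreover have "(d * y1 - c * y2) / ?D * a + (a * y2 - b * y1) / ?D * c = y1"
      "(d * y1 - c * y2) / ?D * b + (a * y2 - b * y1) / ?D * d = y2"
      using that(2) by (simp_all add: divide_simps) (simp_all add: algebra_simps)
    ultimately show ?thesis by (simp only:)
  qed
  ultimately show thesis using that(2,3) ab(2) by metis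
qed

section \<open>The image of a subalgebra in the linear matrices\<close>

definition lin :: "aff2 set \<Rightarrow> complex \<Rightarrow> complex \<Rightarrow> complex \<Rightarrow> complex \<Rightarrow> bool"
  where "lin S x1 x2 x3 x4 \<longleftrightarrow> (\<exists>y1 y2. el x1 x2 x3 x4 y1 y2 \<in> S)"

lemma lin_translated: "lin (translated u1 u2 S) = lin S"
proof -
  have "lin (translated u1 u2 S) x1 x2 x3 x4 \<longleftrightarrow> lin S x1 x2 x3 x4" for x1 x2 x3 x4
    unfolding lin_def mem_translated by (metis diff_add_cancel add_diff_cancel)
  then show ?thesis by blast
qed

lemma lin_scaled:
  assumes "p \<noteq> 0" "q \<noteq> 0"
  shows "lin (transformed p 0 0 q S) x1 x2 x3 x4 \<longleftrightarrow> lin S (q / p * x1) x2 (p / q * x3) x4"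
  unfolding lin_def scaled(3)[OF assms] by (metis assms nonzero_mult_div_cancel_left times_divide_eq_right)

lemma lin_swapped: "lin (transformed 0 1 1 0 S) x1 x2 x3 x4 \<longleftrightarrow> lin S (- x3) (- x2) (- x1) x4"
  unfolding lin_def swapped(3) by blast

lemmas label_simps = el_simps label_subalgebra_iff lin_def[of "label_subalgebra _"]

lemma lin_el: "el x1 x2 x3 x4 y1 y2 \<in> S \<Longrightarrow> lin S x1 x2 x3 x4"
  by (auto simp: lin_def)

text \<open>Two elements with the same linear part differ by a translation. So once the generators
  lie in \<open>S\<close>, bounding separately the linear part and the translations forces equality,
  with no dimension count.\<close>

lemma classifiedI:
  assumes S: "aff2_subalgebra S" and L: "admissible_label L"
    and gens: "label_generators L \<subseteq> S"
    and lin: "\<And>x1 x2 x3 x4. lin S x1 x2 x3 x4 \<Longrightarrow> lin (label_subalgebra L) x1 x2 x3 x4"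
    and trans: "\<And>y1 y2. el 0 0 0 0 y1 y2 \<in> S \<Longrightarrow> el 0 0 0 0 y1 y2 \<in> label_subalgebra L"
  shows "classified S"
proof -
  have sub: "label_subalgebra L \<subseteq> S"
    using S gens aff2.span_minimal unfolding label_subalgebra_def aff2_subalgebra_def by metis
  have "X \<in> label_subalgebra L" if X: "X \<in> S" for X
  proof (cases X rule: aff2_exhaust)
    case (el x1 x2 x3 x4 y1 y2)
    then obtain y1' y2' where y: "el x1 x2 x3 x4 y1' y2' \<in> label_subalgebra L"
      using lin X unfolding lin_def by blast
    then have "el x1 x2 x3 x4 y1' y2' \<in> S" using sub by blast
    then have "el 0 0 0 0 (y1 - y1') (y2 - y2') \<in> S"
      using subalgebra_diff[OF S X[unfolded el]] by fastforce
    from subalgebra_add[OF aff2_subalgebra_label trans[OF this] y] show ?thesis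
      by (simp add: el)
  qed
  then have "S = label_subalgebra L" using sub by blast
  then show ?thesis unfolding classified_def using L aff2_equiv_refl by blast
qed

section \<open>Subalgebras with a given linear part\<close>

text \<open>\<open>e4\<close> acts as half the identity, which is invertible, so one translation
  frees it of its vector part. Its bracket with any other element is then half the vector part of
  that element, which can therefore be subtracted: the whole linear part lies in the subalgebra
  without vector parts.\<close>

lemma reduce_to_e4:
  assumes S: "aff2_subalgebra S" and "lin S 0 0 0 1"
    and c: "\<And>S'. aff2_subalgebra S' \<Longrightarrow> lin S' = lin S \<Longrightarrow>
      (\<And>x1 x2 x3 x4. lin S x1 x2 x3 x4 \<Longrightarrow> el x1 x2 x3 x4 0 0 \<in> S') \<Longrightarrow> classified S'"
  shows "classified S"
proof -
  obtain a b where ab: "el 0 0 0 1 a b \<in> S" using assms(2) by (auto simp: lin_def)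
  let ?S = "translated (- 2 * a) (- 2 * b) S"
  have S': "aff2_subalgebra ?S" by (rule translated(1)[OF S])
  have e4: "el 0 0 0 1 0 0 \<in> ?S" using ab by (simp add: mem_translated)
  have "el x1 x2 x3 x4 0 0 \<in> ?S" if x: "lin S x1 x2 x3 x4" for x1 x2 x3 x4
  proof -
    obtain y1 y2 where y: "el x1 x2 x3 x4 y1 y2 \<in> ?S"
      using x unfolding lin_translated[of "- 2 * a" "- 2 * b" S, symmetric] lin_def by blast
    have "el 0 0 0 0 (y1 / 2) (y2 / 2) \<in> ?S"
      using subalgebra_bracket[OF S' e4 y] by simp
    from subalgebra_diff[OF S' y subalgebra_scale[OF S' this, of 2]] show ?thesis
      by simp
  qed
  from c[OF S' lin_translated this] show ?thesis by (rule translated(2))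
qed

text \<open>The vector part of the lift drops out because translations commute.\<close>

lemma translation_invariant:
  assumes S: "aff2_subalgebra S" and "lin S x1 x2 x3 x4" and v: "el 0 0 0 0 a b \<in> S"
  shows "el 0 0 0 0 ((x2 + x4) / 2 * a - x3 * b) (x1 * a + (x4 - x2) / 2 * b) \<in> S"
proof -
  obtain y1 y2 where "el x1 x2 x3 x4 y1 y2 \<in> S" using assms(2) by (auto simp: lin_def)
  from subalgebra_bracket[OF S this v] show ?thesis by simp
qed

lemma lin_transformed_scalar:
  assumes D: "p * s - q * r \<noteq> 0"
    and H: "\<And>x1 x2 x3 x4. lin S x1 x2 x3 x4 \<Longrightarrow> x1 = 0 \<and> x2 = 0 \<and> x3 = 0"
    and x: "lin (transformed p q r s S) x1 x2 x3 x4"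
  shows "x1 = 0 \<and> x2 = 0 \<and> x3 = 0 \<and> lin S 0 0 0 x4"
proof -
  let ?x1 = "s\<^sup>2 * x1 + r * s * x2 + r\<^sup>2 * x3"
  let ?x2 = "2 * q * s * x1 + (p * s + q * r) * x2 + 2 * p * r * x3"
  let ?x3 = "q\<^sup>2 * x1 + p * q * x2 + p\<^sup>2 * x3"
  have *: "lin S (?x1 / (p * s - q * r)) (?x2 / (p * s - q * r)) (?x3 / (p * s - q * r)) x4"
    using x unfolding lin_def transformed(3)[OF D] by blast
  then have 0: "?x1 = 0" "?x2 = 0" "?x3 = 0" using H[OF *] D by simp_all
  \<comment> \<open>These are the formulas for conjugation by the inverse matrix, with denominators
    cleared.\<close>
  have "(p * s - q * r)\<^sup>2 * x1 = p\<^sup>2 * ?x1 - p * r * ?x2 + r\<^sup>2 * ?x3"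
    "(p * s - q * r)\<^sup>2 * x2 = (p * s + q * r) * ?x2 - 2 * p * q * ?x1 - 2 * r * s * ?x3"
    "(p * s - q * r)\<^sup>2 * x3 = q\<^sup>2 * ?x1 - q * s * ?x2 + s\<^sup>2 * ?x3"
    by algebra+
  then show ?thesis using D * unfolding 0 by simp
qed

text \<open>The first column of the base change is the direction of the line, so \<open>f1\<close>
  is sent to it; any second column completing a basis will do. Such a change is free when the linear
  part consists of scalars.\<close>

lemma align_line:
  assumes "a \<noteq> 0 \<or> b \<noteq> 0" and V: "\<And>y1 y2. el 0 0 0 0 y1 y2 \<in> S \<longleftrightarrow> a * y2 = b * y1"
  obtains q s where "a * s - q * b \<noteq> 0"
    "\<And>y1 y2. el 0 0 0 0 y1 y2 \<in> transformed a q b s S \<longleftrightarrow> y2 = 0"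
proof -
  obtain q s where D: "a * s - q * b \<noteq> 0"
    using assms(1) by (metis diff_zero mult_zero_left mult_1_right mult_1 diff_0 neg_equal_0_iff_equal)
  have "el 0 0 0 0 y1 y2 \<in> transformed a q b s S \<longleftrightarrow> y2 = 0" for y1 y2
  proof -
    have "a * (b * y1 + s * y2) = b * (a * y1 + q * y2) \<longleftrightarrow> (a * s - q * b) * y2 = 0"
      by (auto simp: algebra_simps)
    then show ?thesis using D by (simp add: transformed(3)[OF D] V)
  qed
  with D show thesis by (rule that)
qed

lemma classified_translations:
  assumes S: "aff2_subalgebra S"
    and H: "\<And>x1 x2 x3 x4. lin S x1 x2 x3 x4 \<longleftrightarrow> x1 = 0 \<and> x2 = 0 \<and> x3 = 0 \<and> x4 = 0"
  shows "classified S"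
  using S
proof (cases rule: translations_cases)
  case none
  have "X = 0" if "X \<in> S" for X
  proof (cases X rule: aff2_exhaust)
    case (el x1 x2 x3 x4 y1 y2)
    then have "lin S x1 x2 x3 x4" using that by (auto simp: lin_def)
    then show ?thesis using el that none H by (auto simp: el_zero)
  qed
  moreover have "0 \<in> S" using subalgebra_zero[OF S] by (simp add: el_zero)
  ultimately have "S = {0}" by blast
  then show ?thesis by (simp add: classified_def)
next
  case all
  show ?thesis
    by (rule classifiedI[OF S, of S2_1])
      (use all H in \<open>auto simp: el_simps label_subalgebra_iff lin_def\<close>)
next
  case (line a b)
  obtain q s where D: "a * s - q * b \<noteq> 0"
    and V: "\<And>y1 y2. el 0 0 0 0 y1 y2 \<in> transformed a q b s S \<longleftrightarrow> y2 = 0"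
    by (rule align_line[OF line]) (rule that)
  have "x1 = 0 \<and> x2 = 0 \<and> x3 = 0 \<and> x4 = 0" if "lin (transformed a q b s S) x1 x2 x3 x4" for x1 x2 x3 x4
  proof -
    have "x1 = 0 \<and> x2 = 0 \<and> x3 = 0 \<and> lin S 0 0 0 x4"
      by (rule lin_transformed_scalar[OF D _ that]) (simp add: H)
    then show ?thesis by (simp add: H)
  qed
  from V this show ?thesis
    by (intro transformed(2)[OF D, of S], intro classifiedI[OF transformed(1)[OF D S], of S1_1])
      (auto simp: label_simps)
qed

lemma classified_e4:
  assumes S: "aff2_subalgebra S"
    and H: "\<And>x1 x2 x3 x4. lin S x1 x2 x3 x4 \<longleftrightarrow> x1 = 0 \<and> x2 = 0 \<and> x3 = 0"
  shows "classified S"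
proof (rule reduce_to_e4[OF S])
  fix T assume T: "aff2_subalgebra T" "lin T = lin S"
    and lift: "\<And>x1 x2 x3 x4. lin S x1 x2 x3 x4 \<Longrightarrow> el x1 x2 x3 x4 0 0 \<in> T"
  note H' = H[folded T(2)] lift[unfolded H]
  show "classified T" using T(1)
  proof (cases rule: translations_cases)
    case none
    show ?thesis
      by (rule classifiedI[OF T(1), of S1_3])
        (use none H' in \<open>auto simp: label_simps\<close>)
  next
    case all
    show ?thesis
      by (rule classifiedI[OF T(1), of S3_2])
        (use all H' in \<open>auto simp: label_simps\<close>)
  next
    case (line a b)
    obtain q s where D: "a * s - q * b \<noteq> 0"
      and V: "\<And>y1 y2. el 0 0 0 0 y1 y2 \<in> transformed a q b s T \<longleftrightarrow> y2 = 0"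
      by (rule align_line[OF line]) (rule that)
    have "x1 = 0 \<and> x2 = 0 \<and> x3 = 0" if "lin (transformed a q b s T) x1 x2 x3 x4" for x1 x2 x3 x4
    proof -
      have "x1 = 0 \<and> x2 = 0 \<and> x3 = 0 \<and> lin T 0 0 0 x4"
        by (rule lin_transformed_scalar[OF D _ that]) (simp add: H')
      then show ?thesis by simp
    qed
    moreover have "el 0 0 0 1 0 0 \<in> transformed a q b s T"
      using H'(2) by (simp add: transformed(3)[OF D])
    ultimately show ?thesis
      by (intro transformed(2)[OF D, of T], intro classifiedI[OF transformed(1)[OF D T(1)], of S2_3])
        (use V in \<open>auto simp: label_simps\<close>)
  qed
qed (simp add: H)

text \<open>\<open>e1\<close> maps the plane onto the line of \<open>f2\<close>, so a translation
  removes the \<open>f2\<close> component, and the class is the coefficient of \<open>f1\<close>.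
  The only invariant line is that of \<open>f2\<close>, so the class survives unless all
  translations are present.\<close>

lemma classified_e1:
  assumes S: "aff2_subalgebra S"
    and H: "\<And>x1 x2 x3 x4. lin S x1 x2 x3 x4 \<longleftrightarrow> x2 = 0 \<and> x3 = 0 \<and> x4 = 0"
  shows "classified S"
proof -
  have reduced: "classified T" if T: "aff2_subalgebra T" and H: "lin T = lin S"
    and lift: "el 1 0 0 0 \<delta> 0 \<in> T" and \<delta>: "\<delta> \<in> {0, 1}" for T \<delta>
    using T
  proof (cases rule: translations_cases)
    case none
    show ?thesis
      by (rule classifiedI[OF T, of "S1_2 \<delta>"])
        (use none H assms(2) lift \<delta> in \<open>auto simp: label_simps\<close>)
  next
    case all
    have "el 1 0 0 0 0 0 \<in> T" using subalgebra_diff[OF T lift all[of \<delta> 0]] by simp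
    then show ?thesis
      by (intro classifiedI[OF T, of S3_1])
        (use all H assms(2) in \<open>auto simp: label_simps\<close>)
  next
    case (line a b)
    have "el 0 0 0 0 a b \<in> T" by (simp add: line)
    from translation_invariant[OF T lin_el[OF lift] this] have "a = 0" by (simp add: line)
    then show ?thesis
      by (intro classifiedI[OF T, of "S2_2 \<delta>"])
        (use line H assms(2) lift \<delta> in \<open>auto simp: label_simps\<close>)
  qed
  have "lin S 1 0 0 0" by (simp add: H)
  then obtain a b where ab: "el 1 0 0 0 a b \<in> S" by (auto simp: lin_def)
  let ?S = "translated (- b) 0 S"
  have S': "aff2_subalgebra ?S" by (rule translated(1)[OF S])
  have lift: "el 1 0 0 0 a 0 \<in> ?S" using ab by (simp add: mem_translated)
  have "classified ?S"
  proof (cases "a = 0")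
    case True
    then show ?thesis using reduced[OF S' lin_translated] lift by blast
  next
    case False
    \<comment> \<open>The scalar matrix \<open>a\<close> fixes \<open>e1\<close> and turns the
      vector part \<open>a f1\<close> into \<open>f1\<close>.\<close>
    let ?T = "transformed a 0 0 a ?S"
    have "lin ?T x1 x2 x3 x4 \<longleftrightarrow> lin S x1 x2 x3 x4" for x1 x2 x3 x4
      using False by (simp add: lin_scaled lin_translated)
    then have "lin ?T = lin S" by blast
    moreover have "el 1 0 0 0 1 0 \<in> ?T" using lift False by (simp add: scaled)
    ultimately show ?thesis
      using False reduced scaled(1,2)[OF False False] S' by blast
  qed
  then show ?thesis by (rule translated(2))
qed

lemma classified_e1_plus_e4:
  assumes S: "aff2_subalgebra S"
    and H: "\<And>x1 x2 x3 x4. lin S x1 x2 x3 x4 \<longleftrightarrow> x2 = 0 \<and> x3 = 0 \<and> x4 = x1"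
  shows "classified S"
proof -
  have "lin S 1 0 0 1" by (simp add: H)
  then obtain a b where ab: "el 1 0 0 1 a b \<in> S" by (auto simp: lin_def)
  \<comment> \<open>The linear part of \<open>e1 + e4\<close> is invertible with double eigenvalue
    1/2; this vector solves the triangular system that cancels \<open>(a, b)\<close>.\<close>
  define T where "T = translated (- 2 * a) (4 * a - 2 * b) S"
  have T: "aff2_subalgebra T" unfolding T_def by (rule translated(1)[OF S])
  have lift: "el 1 0 0 1 0 0 \<in> T" using ab by (simp add: T_def mem_translated field_simps)
  have H': "lin T x1 x2 x3 x4 \<longleftrightarrow> x2 = 0 \<and> x3 = 0 \<and> x4 = x1" for x1 x2 x3 x4
    by (simp add: T_def lin_translated H)
  have "classified T" using T
  proof (cases rule: translations_cases)
    case none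
    show ?thesis
      by (rule classifiedI[OF T, of S1_6])
        (use none H' lift in \<open>auto simp: label_simps\<close>)
  next
    case all
    show ?thesis
      by (rule classifiedI[OF T, of S3_4])
        (use all H' lift in \<open>auto simp: label_simps\<close>)
  next
    case (line c d)
    have "el 0 0 0 0 c d \<in> T" by (simp add: line)
    from translation_invariant[OF T lin_el[OF lift] this] have "c = 0"
      by (simp add: line field_simps)
    then show ?thesis
      by (intro classifiedI[OF T, of S2_7])
        (use line H' lift in \<open>auto simp: label_simps\<close>)
  qed
  then show ?thesis unfolding T_def by (rule translated(2))
qed

lemma classified_e1_e4:
  assumes S: "aff2_subalgebra S"
    and H: "\<And>x1 x2 x3 x4. lin S x1 x2 x3 x4 \<longleftrightarrow> x2 = 0 \<and> x3 = 0"
  shows "classified S"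
proof (rule reduce_to_e4[OF S])
  fix T assume T: "aff2_subalgebra T" "lin T = lin S"
    and lift: "\<And>x1 x2 x3 x4. lin S x1 x2 x3 x4 \<Longrightarrow> el x1 x2 x3 x4 0 0 \<in> T"
  note H' = H[folded T(2)] lift[unfolded H]
  show "classified T" using T(1)
  proof (cases rule: translations_cases)
    case none
    show ?thesis
      by (rule classifiedI[OF T(1), of S2_8])
        (use none H' in \<open>auto simp: label_simps\<close>)
  next
    case all
    show ?thesis
      by (rule classifiedI[OF T(1), of S4_1])
        (use all H' in \<open>auto simp: label_simps\<close>)
  next
    case (line a b)
    have "el 0 0 0 0 a b \<in> T" "lin T 1 0 0 0" by (simp_all add: line H')
    from translation_invariant[OF T(1) this(2,1)] have "a = 0" by (simp add: line)
    then show ?thesis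
      by (intro classifiedI[OF T(1), of S3_5])
        (use line H' in \<open>auto simp: label_simps\<close>)
  qed
qed (simp add: H)

lemma classified_borel:
  assumes S: "aff2_subalgebra S"
    and H: "\<And>x1 x2 x3 x4. lin S x1 x2 x3 x4 \<longleftrightarrow> x3 = 0"
  shows "classified S"
proof (rule reduce_to_e4[OF S])
  fix T assume T: "aff2_subalgebra T" "lin T = lin S"
    and lift: "\<And>x1 x2 x3 x4. lin S x1 x2 x3 x4 \<Longrightarrow> el x1 x2 x3 x4 0 0 \<in> T"
  note H' = H[folded T(2)] lift[unfolded H]
  show "classified T" using T(1)
  proof (cases rule: translations_cases)
    case none
    show ?thesis
      by (rule classifiedI[OF T(1), of S3_10])
        (use none H' in \<open>auto simp: label_simps\<close>)
  next
    case all
    show ?thesis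
      by (rule classifiedI[OF T(1), of S5_1])
        (use all H' in \<open>auto simp: label_simps\<close>)
  next
    case (line a b)
    have "el 0 0 0 0 a b \<in> T" "lin T 1 0 0 0" by (simp_all add: line H')
    from translation_invariant[OF T(1) this(2,1)] have "a = 0" by (simp add: line)
    then show ?thesis
      by (intro classifiedI[OF T(1), of S4_4])
        (use line H' in \<open>auto simp: label_simps\<close>)
  qed
qed (simp add: H)

text \<open>The invariant lines are the two axes, and their exchange preserves this linear part, so
  a single label covers both.\<close>

lemma classified_e2_e4:
  assumes S: "aff2_subalgebra S"
    and H: "\<And>x1 x2 x3 x4. lin S x1 x2 x3 x4 \<longleftrightarrow> x1 = 0 \<and> x3 = 0"
  shows "classified S"
proof (rule reduce_to_e4[OF S])
  fix T assume T: "aff2_subalgebra T" "lin T = lin S"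
    and lift: "\<And>x1 x2 x3 x4. lin S x1 x2 x3 x4 \<Longrightarrow> el x1 x2 x3 x4 0 0 \<in> T"
  note H' = H[folded T(2)] lift[unfolded H]
  show "classified T" using T(1)
  proof (cases rule: translations_cases)
    case none
    show ?thesis
      by (rule classifiedI[OF T(1), of S2_9])
        (use none H' in \<open>auto simp: label_simps\<close>)
  next
    case all
    show ?thesis
      by (rule classifiedI[OF T(1), of S4_2])
        (use all H' in \<open>auto simp: label_simps\<close>)
  next
    case (line a b)
    have "el 0 0 0 0 a b \<in> T" "lin T 0 1 0 0" by (simp_all add: line H')
    from translation_invariant[OF T(1) this(2,1)] have "a = 0 \<or> b = 0" by (auto simp: line)
    then show ?thesis
    proof
      assume "b = 0"
      then show ?thesis
        by (intro classifiedI[OF T(1), of S3_6])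
          (use line H' in \<open>auto simp: label_simps\<close>)
    next
      assume "a = 0"
      then show ?thesis
        by (intro swapped(2)[of T], intro classifiedI[OF swapped(1)[OF T(1)], of S3_6])
          (use line H' in \<open>auto simp: label_simps
            lin_swapped swapped\<close>)
    qed
  qed
qed (simp add: H)

lemma classified_gl2:
  assumes S: "aff2_subalgebra S" and H: "\<And>x1 x2 x3 x4. lin S x1 x2 x3 x4"
  shows "classified S"
proof (rule reduce_to_e4[OF S])
  fix T assume T: "aff2_subalgebra T" "lin T = lin S"
    and lift: "\<And>x1 x2 x3 x4. lin S x1 x2 x3 x4 \<Longrightarrow> el x1 x2 x3 x4 0 0 \<in> T"
  note H' = H[folded T(2)] lift[OF H]
  show "classified T" using T(1)
  proof (cases rule: translations_cases)
    case none
    show ?thesis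
      by (rule classifiedI[OF T(1), of S4_5])
        (use none H' in \<open>auto simp: label_simps\<close>)
  next
    case all
    have "X \<in> T" for X
    proof (cases X rule: aff2_exhaust)
      case (el x1 x2 x3 x4 y1 y2)
      then show ?thesis using subalgebra_add[OF T(1) H'(2) all] by fastforce
    qed
    then have "T = UNIV" by blast
    then show ?thesis by (simp add: classified_def)
  next
    case (line a b)
    have "el 0 0 0 0 a b \<in> T" by (simp add: line)
    from translation_invariant[OF T(1) H'(1)[of 1 0 0 0] this]
      translation_invariant[OF T(1) H'(1)[of 0 0 1 0] this]
    have False using line by simp
    then show ?thesis ..
  qed
qed (simp add: H)

text \<open>Whitehead's first lemma by hand. \<open>e2\<close> is invertible on the plane and is
  freed of its vector part by a translation. Bracketing with \<open>e2\<close> acts on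
  \<open>e1\<close>, \<open>e3\<close> by -1, 1, but on \<open>f1\<close>, \<open>f2\<close> by 1/2,
  -1/2.\<close>

lemma classified_sl2:
  assumes S: "aff2_subalgebra S"
    and H: "\<And>x1 x2 x3 x4. lin S x1 x2 x3 x4 \<longleftrightarrow> x4 = 0"
  shows "classified S"
proof -
  have "lin S 0 1 0 0" by (simp add: H)
  then obtain a b where ab: "el 0 1 0 0 a b \<in> S" by (auto simp: lin_def)
  define T where "T = translated (- 2 * a) (2 * b) S"
  have T: "aff2_subalgebra T" unfolding T_def by (rule translated(1)[OF S])
  have e2: "el 0 1 0 0 0 0 \<in> T" using ab by (simp add: T_def mem_translated)
  have H': "lin T x1 x2 x3 x4 \<longleftrightarrow> x4 = 0" for x1 x2 x3 x4
    by (simp add: T_def lin_translated H)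
  have "lin T 1 0 0 0" "lin T 0 0 1 0" by (simp_all add: H')
  then obtain p q r s where pq: "el 1 0 0 0 p q \<in> T" and rs: "el 0 0 1 0 r s \<in> T"
    by (auto simp: lin_def)
  \<comment> \<open>The mismatch of weights leaves nonzero multiples of the vector components as
    pure translations; without translations they must vanish.\<close>
  have pq': "el 0 0 0 0 (3 / 2 * p) (q / 2) \<in> T"
    using subalgebra_add[OF T pq subalgebra_bracket[OF T e2 pq]] by simp
  have rs': "el 0 0 0 0 (r / 2) (3 / 2 * s) \<in> T"
    using subalgebra_diff[OF T rs subalgebra_bracket[OF T e2 rs]] by simp
  have "classified T" using T
  proof (cases rule: translations_cases)
    case none
    show ?thesis
      by (rule classifiedI[OF T, of S3_11])
        (use none H' e2 pq rs pq' rs' in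
          \<open>auto simp: label_simps\<close>)
  next
    case all
    have "el 1 0 0 0 0 0 \<in> T" "el 0 0 1 0 0 0 \<in> T"
      using subalgebra_diff[OF T pq all[of p q]] subalgebra_diff[OF T rs all[of r s]] by simp_all
    then show ?thesis
      by (intro classifiedI[OF T, of S5_2])
        (use all H' e2 in \<open>auto simp: label_simps\<close>)
  next
    case (line c d)
    have "el 0 0 0 0 c d \<in> T" by (simp add: line)
    from translation_invariant[OF T _ this, of 1 0 0 0] translation_invariant[OF T _ this, of 0 0 1 0]
    have False using line by (simp add: H')
    then show ?thesis ..
  qed
  then show ?thesis unfolding T_def by (rule translated(2))
qed

section \<open>The parameter half plane\<close>

lemma polar_params_nonneg:
  "z \<in> polar_params {0..} \<longleftrightarrow> z = 0 \<or> Re z > 0 \<or> Re z = 0 \<and> Im z > 0"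
proof
  assume "z \<in> polar_params {0..}"
  then obtain \<rho> \<phi> where z: "z = of_real \<rho> * exp (\<i> * of_real \<phi>)"
    and \<rho>: "\<rho> \<ge> 0" and \<phi>: "- pi / 2 < \<phi>" "\<phi> \<le> pi / 2"
    by (auto simp: polar_params_def)
  have re: "Re z = \<rho> * cos \<phi>" and im: "Im z = \<rho> * sin \<phi>" by (simp_all add: z Re_exp Im_exp)
  consider "\<rho> = 0" | "\<rho> > 0" "\<phi> = pi / 2" | "\<rho> > 0" "\<phi> < pi / 2" using \<rho> \<phi> by linarith
  then show "z = 0 \<or> Re z > 0 \<or> Re z = 0 \<and> Im z > 0"
  proof cases
    case 2
    then have "Re z = 0" "Im z > 0" using re im by (simp_all only: cos_pi_half sin_pi_half)
    then show ?thesis by simp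
  next
    case 3
    then have "cos \<phi> > 0" using \<phi> by (intro cos_gt_zero_pi) auto
    then show ?thesis using 3 re by simp
  qed (simp add: z)
next
  assume *: "z = 0 \<or> Re z > 0 \<or> Re z = 0 \<and> Im z > 0"
  show "z \<in> polar_params {0..}"
  proof (cases "z = 0")
    case True
    then show ?thesis
      unfolding polar_params_def by (auto intro!: exI[of _ "0::real"])
  next
    case False
    have "- pi / 2 < Arg z \<and> Arg z \<le> pi / 2"
    proof (cases "Re z > 0")
      case True
      then show ?thesis using False Re_Ln_pos_lt[of z] by (auto simp: Arg_eq_Im_Ln)
    next
      case re: False
      then have "z = \<i> * of_real (Im z)" "Im z > 0" using * False by (auto simp: complex_eq_iff)
      then have "Arg z = pi / 2" by (metis Arg_times_of_real2 Arg_ii)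
      show ?thesis unfolding \<open>Arg z = pi / 2\<close> by simp
    qed
    moreover have "z = of_real (norm z) * exp (\<i> * of_real (Arg z))"
      using Arg_eq[OF False] by (simp add: cis_conv_exp)
    ultimately show ?thesis unfolding polar_params_def by fastforce
  qed
qed

lemma polar_params_pos: "z \<in> polar_params {0<..} \<longleftrightarrow> z \<in> polar_params {0..} \<and> z \<noteq> 0"
  unfolding polar_params_def
  by (auto simp: order.order_iff_strict[of 0])

text \<open>The half plane contains only one of its two boundary rays, so it is a fundamental domain
  for \<open>z \<mapsto> - z\<close>, the ambiguity caused by exchanging the axes.\<close>

lemma polar_params_cases: "z \<in> polar_params {0..} \<or> - z \<in> polar_params {0..}"
  by (auto simp: polar_params_nonneg complex_eq_iff)

lemma polar_params_uminus: "z \<in> polar_params {0..} \<Longrightarrow> - z \<in> polar_params {0..} \<Longrightarrow> z = 0"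
  by (auto simp: polar_params_nonneg)

text \<open>The eigenvalues are \<open>(z + 1) / 2\<close> on \<open>f1\<close> and
  \<open>(z - 1) / 2\<close> on \<open>f2\<close>. The half plane excludes -1, so the
  \<open>f1\<close> component can always be removed, and the \<open>f2\<close> component resists
  only at \<open>z = 1\<close>.\<close>

lemma classified_e2_plus_e4:
  assumes S: "aff2_subalgebra S" and z: "z \<in> polar_params {0..}"
    and H: "\<And>x1 x2 x3 x4. lin S x1 x2 x3 x4 \<longleftrightarrow> x1 = 0 \<and> x3 = 0 \<and> x4 = z * x2"
  shows "classified S"
proof -
  have zpos: "z \<noteq> 0 \<Longrightarrow> z \<in> polar_params {0<..}" using z by (simp add: polar_params_pos)
  have "z \<noteq> - 1" using z by (auto simp: polar_params_nonneg)
  then have z1: "1 + z \<noteq> 0" by (simp add: add_eq_0_iff)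
  have reduced: "classified T" if T: "aff2_subalgebra T" and "lin T = lin S"
    and lift: "el 0 1 0 z 0 \<epsilon> \<in> T" and \<epsilon>: "\<epsilon> = 0 \<or> \<epsilon> = 1 \<and> z = 1" for T \<epsilon>
  proof -
    have H': "lin T x1 x2 x3 x4 \<longleftrightarrow> x1 = 0 \<and> x3 = 0 \<and> x4 = z * x2" for x1 x2 x3 x4
      by (simp add: that H)
    show ?thesis using T
    proof (cases rule: translations_cases)
      case none
      show ?thesis using \<epsilon>
      proof
        assume "\<epsilon> = 0"
        then show ?thesis
          by (intro classifiedI[OF T, of "S1_4 z"])
            (use none H' z lift in \<open>auto simp: label_simps\<close>)
      next
        assume "\<epsilon> = 1 \<and> z = 1"
        then show ?thesis
          by (intro classifiedI[OF T, of S1_5])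
            (use none H' lift in \<open>auto simp: label_simps\<close>)
      qed
    next
      case all
      have "el 0 1 0 z 0 0 \<in> T" using subalgebra_diff[OF T lift all[of 0 \<epsilon>]] by simp
      then show ?thesis
        by (intro classifiedI[OF T, of "S3_3 z"])
          (use all H' z in \<open>auto simp: label_simps\<close>)
    next
      case (line a b)
      have "el 0 0 0 0 a b \<in> T" by (simp add: line)
      from translation_invariant[OF T lin_el[OF lift] this] have "a * b = 0"
        by (simp add: line field_simps)
      then show ?thesis unfolding mult_eq_0_iff
      proof
        assume "a = 0"
        then have V: "el 0 0 0 0 y1 y2 \<in> T \<longleftrightarrow> y1 = 0" for y1 y2 using line by auto
        have lift': "el 0 1 0 z 0 0 \<in> T"
          using subalgebra_diff[OF T lift V[of 0 \<epsilon>, THEN iffD2]] by simp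
        show ?thesis
        \<comment> \<open>At \<open>z = 0\<close> exchanging the axes turns the line of
          \<open>f2\<close> into that of \<open>f1\<close>, which is why \<open>S2_5\<close> leaves
          out the parameter 0.\<close>
        proof (cases "z = 0")
          case True
          have "el 0 1 0 0 0 0 \<in> transformed 0 1 1 0 T"
            using subalgebra_scale[OF T lift', of "- 1"] True by (simp add: swapped)
          then show ?thesis
            by (intro swapped(2)[of T], intro classifiedI[OF swapped(1)[OF T], of "S2_4 0"])
              (use True V H' z in \<open>auto simp: label_simps lin_swapped swapped\<close>)
        next
          case False
          show ?thesis
            by (rule classifiedI[OF T, of "S2_5 z"])
              (use False V H' zpos lift' in
                \<open>auto simp: label_simps\<close>)
        qed
      next
        assume "b = 0"
        then have V: "el 0 0 0 0 y1 y2 \<in> T \<longleftrightarrow> y2 = 0" for y1 y2 using line by auto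
        show ?thesis using \<epsilon>
        proof
          assume "\<epsilon> = 0"
          then show ?thesis
            by (intro classifiedI[OF T, of "S2_4 z"])
              (use V H' z lift in \<open>auto simp: label_simps\<close>)
        next
          assume "\<epsilon> = 1 \<and> z = 1"
          then show ?thesis
            by (intro classifiedI[OF T, of S2_6])
              (use V H' lift in \<open>auto simp: label_simps\<close>)
        qed
      qed
    qed
  qed
  have "lin S 0 1 0 z" by (simp add: H)
  then obtain a b where ab: "el 0 1 0 z a b \<in> S" by (auto simp: lin_def)
  \<comment> \<open>At \<open>z = 1\<close> this coordinate of the translation has no effect and is
    set to 0.\<close>
  define u2 where "u2 = (if z = 1 then 0 else - 2 * b / (z - 1))"
  define T where "T = translated (- 2 * a / (1 + z)) u2 S"
  have T: "aff2_subalgebra T" unfolding T_def by (rule translated(1)[OF S])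
  have TH: "lin T = lin S" by (simp add: T_def lin_translated)
  have a0: "(1 + z) * (2 * a) / ((1 + z) * 2) = a"
    using mult_divide_mult_cancel_left[OF z1, of "2 * a" 2] by simp
  have "classified T"
  proof (cases "z = 1 \<and> b \<noteq> 0")
    case False
    then have "el 0 1 0 z 0 0 \<in> T" using ab z1 a0 by (auto simp: T_def mem_translated u2_def)
    then show ?thesis using reduced[OF T TH] by blast
  next
    case True
    then have lift: "el 0 1 0 1 0 b \<in> T" using ab z1 by (auto simp: T_def mem_translated u2_def)
    \<comment> \<open>\<open>diag(1, b)\<close> commutes with the diagonal linear part and scales
      the \<open>f2\<close> component to 1.\<close>
    let ?U = "transformed 1 0 0 b T"
    have "lin ?U x1 x2 x3 x4 \<longleftrightarrow> lin S x1 x2 x3 x4" for x1 x2 x3 x4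
      using True by (simp add: lin_scaled TH H)
    then have "lin ?U = lin S" by blast
    moreover have "el 0 1 0 1 0 1 \<in> ?U" using lift True by (simp add: scaled)
    moreover have "aff2_subalgebra ?U" using scaled(1)[OF _ _ T] True by simp
    ultimately have "classified ?U" using True reduced by blast
    then show ?thesis using scaled(2) True by (metis zero_neq_one)
  qed
  then show ?thesis unfolding T_def by (rule translated(2))
qed

text \<open>A cocycle has four components \<open>p, q, a, b\<close>, the vector parts of the lifts
  of \<open>e2 + \<gamma> e4\<close> and of \<open>e1\<close>. Two parameters of a translation and
  the relation \<open>[e2, e1] = - e1\<close> eliminate all of them except at the resonances 1, -1
  and -3 of \<open>\<gamma>\<close>.\<close>

lemma classified_e2_e1:
  assumes S: "aff2_subalgebra S"
    and H: "\<And>x1 x2 x3 x4. lin S x1 x2 x3 x4 \<longleftrightarrow> x3 = 0 \<and> x4 = \<gamma> * x2"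
  shows "classified S"
proof -
  have "lin S 0 1 0 \<gamma>" "lin S 1 0 0 0" by (simp_all add: H)
  then obtain p q a b where X: "el 0 1 0 \<gamma> p q \<in> S" and Y: "el 1 0 0 0 a b \<in> S"
    by (auto simp: lin_def)
  \<comment> \<open>At -1 the coordinate \<open>u1\<close> no longer affects \<open>p\<close>, so it
    is spent on clearing \<open>b\<close>; likewise \<open>u2\<close> loses its effect on
    \<open>q\<close> at 1.\<close>
  define u1 where "u1 = (if \<gamma> = - 1 then - b else - 2 * p / (1 + \<gamma>))"
  define u2 where "u2 = (if \<gamma> = 1 then 0 else - 2 * q / (\<gamma> - 1))"
  define T where "T = translated u1 u2 S"
  have T: "aff2_subalgebra T" unfolding T_def by (rule translated(1)[OF S])
  have TH: "lin T x1 x2 x3 x4 \<longleftrightarrow> x3 = 0 \<and> x4 = \<gamma> * x2" for x1 x2 x3 x4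
    by (simp add: T_def lin_translated H)
  define p' where "p' = (if \<gamma> = - 1 then p else 0)"
  define q' where "q' = (if \<gamma> = 1 then q else 0)"
  define b' where "b' = b + u1"
  have X': "el 0 1 0 \<gamma> p' q' \<in> T"
  proof -
    have "p' - (1 + \<gamma>) / 2 * u1 = p"
    proof (cases "\<gamma> = - 1")
      case False
      then have "1 + \<gamma> \<noteq> 0" by (simp add: add_eq_0_iff)
      then show ?thesis using False by (simp add: p'_def u1_def)
    qed (simp add: p'_def)
    moreover have "q' - (\<gamma> - 1) / 2 * u2 = q"
      by (simp add: q'_def u2_def field_simps)
    ultimately show ?thesis using X by (simp add: T_def mem_translated)
  qed
  have Y': "el 1 0 0 0 a b' \<in> T" using Y by (simp add: T_def mem_translated b'_def)
  \<comment> \<open>The cocycle condition: the lifts satisfy the relation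
    \<open>[e2, e1] = - e1\<close> up to a translation of \<open>T\<close>. The factor
    \<open>3 + \<gamma>\<close> is the source of the value -3.\<close>
  have Z: "el 0 0 0 0 ((3 + \<gamma>) / 2 * a) ((1 + \<gamma>) / 2 * b' - p') \<in> T"
    using subalgebra_add[OF T subalgebra_bracket[OF T X' Y'] Y'] by (simp add: field_simps)
  have b'0: "b' = 0" if "\<gamma> = - 1" using that by (simp add: b'_def u1_def)
  have UH: "lin (transformed c 0 0 d T) x1 x2 x3 x4 \<longleftrightarrow> x3 = 0 \<and> x4 = \<gamma> * x2"
    if "c \<noteq> 0" "d \<noteq> 0" for c d x1 x2 x3 x4
    using that by (simp add: lin_scaled TH)
  have "classified T" using T
  proof (cases rule: translations_cases)
    case none
    have a: "a = 0 \<or> \<gamma> = - 3" and b: "(1 + \<gamma>) * b' = 2 * p'"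
      using Z by (auto simp: none add_eq_0_iff)
    \<comment> \<open>At -1 the choice of \<open>u1\<close> gives \<open>b' = 0\<close> and the
      condition then gives \<open>p' = 0\<close>; elsewhere \<open>p' = 0\<close> by construction
      and \<open>1 + \<gamma>\<close> is invertible.\<close>
    have p0: "p' = 0" and b0: "b' = 0"
      using b b'0 by (auto simp: p'_def add_eq_0_iff split: if_splits)
    show ?thesis
    proof (cases "a = 0")
      case a0: True
      show ?thesis
      proof (cases "q' = 0")
        case True
        then show ?thesis
          by (intro classifiedI[OF T, of "S2_10 \<gamma>"])
            (use none TH X' Y' a0 p0 b0 in
              \<open>auto simp: label_simps\<close>)
      next
        \<comment> \<open>Only the label with parameter 1 arises: at -1 the eigenvalue of
          \<open>f2\<close> is nonzero and \<open>u2\<close> has already removed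
          \<open>q\<close>.\<close>
        case q0: False
        then have \<gamma>: "\<gamma> = 1" by (auto simp: q'_def split: if_splits)
        have "el 0 1 0 1 0 1 \<in> transformed q' 0 0 q' T" "el 1 0 0 0 0 0 \<in> transformed q' 0 0 q' T"
          using X' Y' q0 \<gamma> a0 p0 b0 by (simp_all add: scaled)
        then show ?thesis
          by (intro scaled(2)[OF q0 q0, of T], intro classifiedI[OF scaled(1)[OF q0 q0 T], of "S2_11 1"])
            (use none UH q0 \<gamma> in \<open>auto simp: label_simps scaled\<close>)
      qed
    next
      case a0: False
      then have \<gamma>: "\<gamma> = - 3" using a by blast
      have "el 0 1 0 (- 3) 0 0 \<in> transformed a 0 0 a T" "el 1 0 0 0 1 0 \<in> transformed a 0 0 a T"
        using X' Y' a0 \<gamma> p0 b0 by (simp_all add: scaled q'_def)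
      then show ?thesis
        by (intro scaled(2)[OF a0 a0, of T], intro classifiedI[OF scaled(1)[OF a0 a0 T], of S2_13])
          (use none UH a0 \<gamma> in \<open>auto simp: label_simps scaled\<close>)
    qed
  next
    case all
    have "el 0 1 0 \<gamma> 0 0 \<in> T" "el 1 0 0 0 0 0 \<in> T"
      using subalgebra_diff[OF T X' all[of p' q']] subalgebra_diff[OF T Y' all[of a b']] by simp_all
    then show ?thesis
      by (intro classifiedI[OF T, of "S4_3 \<gamma>"])
        (use all TH in \<open>auto simp: label_simps\<close>)
  next
    case (line c d)
    have "el 0 0 0 0 c d \<in> T" by (simp add: line)
    from translation_invariant[OF T lin_el[OF Y'] this] have "c = 0" by (simp add: line)
    then have V: "el 0 0 0 0 y1 y2 \<in> T \<longleftrightarrow> y1 = 0" for y1 y2 using line by auto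
    \<comment> \<open>With \<open>f2\<close> among the translations, \<open>q'\<close> and
      \<open>b'\<close> are absorbed, and the second component of the cocycle condition becomes
      empty. So \<open>p'\<close> may survive at -1, which gives \<open>S3_8\<close>.\<close>
    have X'': "el 0 1 0 \<gamma> p' 0 \<in> T" and Y'': "el 1 0 0 0 a 0 \<in> T"
      using subalgebra_diff[OF T X' V[of 0 q', THEN iffD2]]
        subalgebra_diff[OF T Y' V[of 0 b', THEN iffD2]] by simp_all
    have a: "a = 0 \<or> \<gamma> = - 3"
      using Z by (auto simp: V add_eq_0_iff)
    show ?thesis
    proof (cases "a = 0")
      case a0: True
      show ?thesis
      proof (cases "p' = 0")
        case True
        then show ?thesis
          by (intro classifiedI[OF T, of "S3_7 \<gamma>"])
            (use V TH X'' Y'' a0 in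
              \<open>auto simp: label_simps\<close>)
      next
        case p0: False
        then have \<gamma>: "\<gamma> = - 1" by (auto simp: p'_def split: if_splits)
        have "el 0 1 0 (- 1) 1 0 \<in> transformed p' 0 0 p' T" "el 1 0 0 0 0 0 \<in> transformed p' 0 0 p' T"
          using X'' Y'' p0 \<gamma> a0 by (simp_all add: scaled)
        then show ?thesis
          by (intro scaled(2)[OF p0 p0, of T], intro classifiedI[OF scaled(1)[OF p0 p0 T], of S3_8])
            (use V UH p0 \<gamma> in \<open>auto simp: label_simps scaled\<close>)
      qed
    next
      case a0: False
      then have \<gamma>: "\<gamma> = - 3" using a by blast
      have "el 0 1 0 (- 3) 0 0 \<in> transformed a 0 0 a T" "el 1 0 0 0 1 0 \<in> transformed a 0 0 a T"
        using X'' Y'' a0 \<gamma> by (simp_all add: scaled p'_def)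
      then show ?thesis
        by (intro scaled(2)[OF a0 a0, of T], intro classifiedI[OF scaled(1)[OF a0 a0 T], of S3_9])
          (use V UH a0 \<gamma> in \<open>auto simp: label_simps scaled\<close>)
    qed
  qed
  then show ?thesis unfolding T_def by (rule translated(2))
qed

section \<open>Normal forms of the linear part\<close>

lemma
  assumes S: "aff2_subalgebra S"
  shows lin_add: "lin S x1 x2 x3 x4 \<Longrightarrow> lin S x1' x2' x3' x4' \<Longrightarrow>
      lin S (x1 + x1') (x2 + x2') (x3 + x3') (x4 + x4')"
    and lin_diff: "lin S x1 x2 x3 x4 \<Longrightarrow> lin S x1' x2' x3' x4' \<Longrightarrow>
      lin S (x1 - x1') (x2 - x2') (x3 - x3') (x4 - x4')"
    and lin_scale: "lin S x1 x2 x3 x4 \<Longrightarrow> lin S (c * x1) (c * x2) (c * x3) (c * x4)"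
    and lin_bracket: "lin S x1 x2 x3 x4 \<Longrightarrow> lin S x1' x2' x3' x4' \<Longrightarrow>
      lin S (x1 * x2' - x2 * x1') (2 * (x1 * x3' - x3 * x1')) (x2 * x3' - x3 * x2') 0"
  unfolding lin_def
  by (blast intro: subalgebra_add[OF S] subalgebra_diff[OF S] subalgebra_scale[OF S]
      subalgebra_bracket[OF S])+

lemma lin_transformed:
  assumes D: "p * s - q * r \<noteq> 0"
  shows "lin (transformed p q r s S) x1 x2 x3 x4 \<longleftrightarrow>
    lin S ((s\<^sup>2 * x1 + r * s * x2 + r\<^sup>2 * x3) / (p * s - q * r))
        ((2 * q * s * x1 + (p * s + q * r) * x2 + 2 * p * r * x3) / (p * s - q * r))
        ((q\<^sup>2 * x1 + p * q * x2 + p\<^sup>2 * x3) / (p * s - q * r)) x4"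
    (is "_ \<longleftrightarrow> lin S ?x1 ?x2 ?x3 x4")
proof
  assume "lin S ?x1 ?x2 ?x3 x4"
  then obtain c d where cd: "el ?x1 ?x2 ?x3 x4 c d \<in> S" by (auto simp: lin_def)
  \<comment> \<open>The inverse base change applied to the vector part
    \<open>(c, d)\<close>.\<close>
  let ?y1 = "(s * c - q * d) / (p * s - q * r)" and ?y2 = "(p * d - r * c) / (p * s - q * r)"
  have "p * ?y1 + q * ?y2 = c" "r * ?y1 + s * ?y2 = d"
    using D by (simp_all add: divide_simps) (simp_all add: algebra_simps)
  then have "el x1 x2 x3 x4 ?y1 ?y2 \<in> transformed p q r s S"
    using cd unfolding transformed(3)[OF D] by (simp only:)
  then show "lin (transformed p q r s S) x1 x2 x3 x4" by (rule lin_el)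
qed (auto simp: lin_def transformed(3)[OF D])

text \<open>The equations say that the matrix with rows \<open>(p, q)\<close>, \<open>(r, s)\<close>
  conjugates \<open>t e2\<close> into the traceless element with coordinates
  \<open>x1, x2, x3\<close>. Here \<open>t\<close> is the difference of the eigenvalues, a square
  root of the discriminant.\<close>

lemma diagonalize_sl2:
  fixes x1 x2 x3 :: complex
  assumes "x2\<^sup>2 - 4 * x1 * x3 \<noteq> 0"
  obtains p q r s t where "p * s - q * r \<noteq> 0" "t \<noteq> 0" "r * s * t = x1 * (p * s - q * r)"
    "(p * s + q * r) * t = x2 * (p * s - q * r)" "p * q * t = x3 * (p * s - q * r)"
proof -
  define t where "t = csqrt (x2\<^sup>2 - 4 * x1 * x3)"
  have t: "t\<^sup>2 = x2\<^sup>2 - 4 * x1 * x3" by (simp add: t_def)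
  have t0: "t \<noteq> 0" using assms t by force
  have pq: "(x2 + t) * (x2 - t) = 4 * x1 * x3"
    using t by (simp add: algebra_simps power2_eq_square)
  consider "x1 \<noteq> 0" | "x1 = 0" "x3 \<noteq> 0" | "x1 = 0" "x3 = 0" by blast
  then show thesis
  proof cases
    case 1
    \<comment> \<open>The columns are eigenvectors for \<open>t / 2\<close> and
      \<open>- t / 2\<close> with lower entry 1; in the next case it is the upper entry that is
      1.\<close>
    let ?p = "(x2 + t) / (2 * x1)" and ?q = "(x2 - t) / (2 * x1)"
    have "?p * 1 - ?q * 1 = t / x1" "?p * 1 + ?q * 1 = x2 / x1"
      using 1 by (simp_all add: field_simps)
    moreover have "?p * ?q = x3 / x1"
      using 1 pq by (simp add: field_simps)
    ultimately show thesis
      using that[of ?p 1 ?q 1 t] 1 t0 by simp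
  next
    case 2
    let ?s = "(x2 + t) / (2 * x3)" and ?r = "(x2 - t) / (2 * x3)"
    have "1 * ?s - 1 * ?r = t / x3" "1 * ?s + 1 * ?r = x2 / x3"
      using 2 by (simp_all add: field_simps)
    moreover have "?r * ?s = x1 / x3"
      using 2 pq by (simp add: field_simps)
    ultimately show thesis
      using that[of 1 ?s 1 ?r t] 2 t0 by simp
  next
    case 3
    then have "x2 \<noteq> 0" using assms by auto
    then show thesis using that[of 1 1 0 0 x2] 3 by simp
  qed
qed

text \<open>The analogue for vanishing discriminant: the matrix conjugates \<open>t e1\<close> into
  the given nilpotent element. Its second column spans the kernel of that element.\<close>

lemma nilpotent_sl2:
  fixes x1 x2 x3 :: complex
  assumes "x2\<^sup>2 = 4 * x1 * x3" "x1 \<noteq> 0 \<or> x2 \<noteq> 0 \<or> x3 \<noteq> 0"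
  obtains p q r s t where "p * s - q * r \<noteq> 0" "t \<noteq> 0" "s\<^sup>2 * t = x1 * (p * s - q * r)"
    "2 * q * s * t = x2 * (p * s - q * r)" "q\<^sup>2 * t = x3 * (p * s - q * r)"
proof (cases "x1 = 0")
  case True
  then show thesis using assms that[of 0 0 1 "- 1" x3] by auto
next
  case False
  have "(x2 / (2 * x1))\<^sup>2 * x1 = x3"
    using False assms(1) by (simp add: power_divide power2_eq_square)
  then show thesis using False that[of 1 1 "x2 / (2 * x1)" 0 x1] by simp
qed

text \<open>Applied to the difference of two elements with the same traceless part, this shows that
  without \<open>e4\<close> the trace is a function of the traceless part.\<close>

lemma not_lin_e4:
  assumes S: "aff2_subalgebra S" and "\<not> lin S 0 0 0 1" "lin S 0 0 0 x4"
  shows "x4 = 0"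
  using lin_scale[OF S assms(3), of "inverse x4"] assms(2) by (cases "x4 = 0") auto

lemma classified_nilpotent:
  assumes S: "aff2_subalgebra S" and e1: "lin S 1 0 0 z"
    and nil: "\<And>x1 x2 x3 x4. lin S x1 x2 x3 x4 \<Longrightarrow> x2\<^sup>2 = 4 * x1 * x3"
  shows "classified S"
proof -
  have *: "x2 = 0 \<and> x3 = 0" if x: "lin S x1 x2 x3 x4" for x1 x2 x3 x4
  proof -
    \<comment> \<open>Polarisation: the discriminant vanishes on a linear space containing
      \<open>e1\<close>, so it stays zero after \<open>e1\<close> is added; comparing the two
      equations gives \<open>x3 = 0\<close>.\<close>
    have "x2\<^sup>2 = 4 * x1 * x3" "x2\<^sup>2 = 4 * (x1 + 1) * x3"
      using nil[OF x] nil[OF lin_add[OF S x e1]] by simp_all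
    then show ?thesis by (simp add: algebra_simps)
  qed
  show ?thesis
  proof (cases "lin S 0 0 0 1")
    case True
    have "lin S x1 0 0 x4" for x1 x4
      using lin_add[OF S lin_scale[OF S e1, of x1] lin_scale[OF S True, of "x4 - x1 * z"]] by simp
    then have "lin S x1 x2 x3 x4 \<longleftrightarrow> x2 = 0 \<and> x3 = 0" for x1 x2 x3 x4 using * by blast
    then show ?thesis by (rule classified_e1_e4[OF S])
  next
    case False
    have H: "lin S x1 x2 x3 x4 \<longleftrightarrow> x2 = 0 \<and> x3 = 0 \<and> x4 = x1 * z" for x1 x2 x3 x4
    proof
      assume x: "lin S x1 x2 x3 x4"
      have "lin S 0 0 0 (x4 - x1 * z)"
        using lin_diff[OF S x lin_scale[OF S e1, of x1]] *[OF x] by simp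
      from not_lin_e4[OF S False this] show "x2 = 0 \<and> x3 = 0 \<and> x4 = x1 * z"
        using *[OF x] by simp
    qed (use lin_scale[OF S e1, of x1] in simp)
    show ?thesis
    proof (cases "z = 0")
      case True
      then show ?thesis by (intro classified_e1[OF S]) (simp add: H)
    next
      case z: False
      show ?thesis
        \<comment> \<open>\<open>diag(z, 1)\<close> rescales \<open>e1\<close> relative to
          \<open>e4\<close>, so that the functional \<open>z\<close> becomes 1.\<close>
        by (rule scaled(2)[OF z one_neq_zero],
            rule classified_e1_plus_e4[OF scaled(1)[OF z one_neq_zero S]])
          (use z in \<open>simp add: lin_scaled H\<close>)
    qed
  qed
qed

lemma classified_diagonal:
  assumes S: "aff2_subalgebra S" and e2: "lin S 0 1 0 z"
    and diag: "\<And>x1 x2 x3 x4. lin S x1 x2 x3 x4 \<Longrightarrow> x1 = 0 \<and> x3 = 0"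
  shows "classified S"
proof (cases "lin S 0 0 0 1")
  case True
  have "lin S 0 x2 0 x4" for x2 x4
    using lin_add[OF S lin_scale[OF S e2, of x2] lin_scale[OF S True, of "x4 - x2 * z"]] by simp
  then have "lin S x1 x2 x3 x4 \<longleftrightarrow> x1 = 0 \<and> x3 = 0" for x1 x2 x3 x4 using diag by blast
  then show ?thesis by (rule classified_e2_e4[OF S])
next
  case False
  have H: "lin S x1 x2 x3 x4 \<longleftrightarrow> x1 = 0 \<and> x3 = 0 \<and> x4 = z * x2" for x1 x2 x3 x4
  proof
    assume x: "lin S x1 x2 x3 x4"
    have "lin S 0 0 0 (x4 - x2 * z)"
      using lin_diff[OF S x lin_scale[OF S e2, of x2]] diag[OF x] by simp
    from not_lin_e4[OF S False this] show "x1 = 0 \<and> x3 = 0 \<and> x4 = z * x2"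
      using diag[OF x] by (simp add: mult.commute)
  qed (use lin_scale[OF S e2, of x2] in \<open>simp add: mult.commute\<close>)
  show ?thesis using polar_params_cases[of z]
  proof
    assume "z \<in> polar_params {0..}"
    then show ?thesis using classified_e2_plus_e4[OF S _ H] by blast
  next
    assume z: "- z \<in> polar_params {0..}"
    show ?thesis
      by (rule swapped(2), rule classified_e2_plus_e4[OF swapped(1)[OF S] z])
        (auto simp: lin_swapped H)
  qed
qed

text \<open>Any element outside the lower triangular matrices yields \<open>e3\<close> by bracketing
  with \<open>e2\<close> and subtracting a multiple of \<open>e1\<close>. Then
  \<open>[e1, e3] = 2 e2\<close> gives \<open>e2\<close> without a scalar part, hence all of
  sl(2).\<close>

lemma classified_triangular:
  assumes S: "aff2_subalgebra S" and e2: "lin S 0 1 0 z" and e1: "lin S 1 0 0 0"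
  shows "classified S"
proof (cases "\<exists>x1 x2 x3 x4. lin S x1 x2 x3 x4 \<and> x3 \<noteq> 0")
  case True
  then obtain x1 x2 x3 x4 where x: "lin S x1 x2 x3 x4" "x3 \<noteq> 0" by blast
  have "lin S (- x1) 0 x3 0" using lin_bracket[OF S e2 x(1)] by simp
  from lin_scale[OF S lin_add[OF S this lin_scale[OF S e1, of x1]], of "1 / x3"]
  have e3: "lin S 0 0 1 0" using x(2) by simp
  have e2': "lin S 0 1 0 0" using lin_scale[OF S lin_bracket[OF S e1 e3], of "1 / 2"] by simp
  have sl2: "lin S x1 x2 x3 0" for x1 x2 x3
    using lin_add[OF S lin_add[OF S lin_scale[OF S e1, of x1] lin_scale[OF S e2', of x2]]
        lin_scale[OF S e3, of x3]] by simp
  show ?thesis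
  proof (cases "lin S 0 0 0 1")
    case True
    have "lin S x1 x2 x3 x4" for x1 x2 x3 x4
      using lin_add[OF S sl2[of x1 x2 x3] lin_scale[OF S True, of x4]] by simp
    then show ?thesis by (rule classified_gl2[OF S])
  next
    case False
    have "lin S x1 x2 x3 x4 \<longleftrightarrow> x4 = 0" for x1 x2 x3 x4
      using not_lin_e4[OF S False, of x4] lin_diff[OF S _ sl2[of x1 x2 x3], of x1 x2 x3 x4]
        sl2 by auto
    then show ?thesis by (rule classified_sl2[OF S])
  qed
next
  case tri: False
  have lower: "lin S x1 x2 0 (x2 * z)" for x1 x2
    using lin_add[OF S lin_scale[OF S e1, of x1] lin_scale[OF S e2, of x2]] by simp
  show ?thesis
  proof (cases "lin S 0 0 0 1")
    case True
    have "lin S x1 x2 0 x4" for x1 x2 x4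
      using lin_add[OF S lower[of x1 x2] lin_scale[OF S True, of "x4 - x2 * z"]] by simp
    then have "lin S x1 x2 x3 x4 \<longleftrightarrow> x3 = 0" for x1 x2 x3 x4 using tri by blast
    then show ?thesis by (rule classified_borel[OF S])
  next
    case False
    have "lin S x1 x2 x3 x4 \<longleftrightarrow> x3 = 0 \<and> x4 = z * x2" for x1 x2 x3 x4
    proof
      assume x: "lin S x1 x2 x3 x4"
      then have x3: "x3 = 0" using tri by blast
      have "lin S 0 0 0 (x4 - x2 * z)" using lin_diff[OF S x lower[of x1 x2]] x3 by simp
      from not_lin_e4[OF S False this] show "x3 = 0 \<and> x4 = z * x2"
        using x3 by (simp add: mult.commute)
    qed (use lower in \<open>simp add: mult.commute\<close>)
    then show ?thesis by (rule classified_e2_e1[OF S])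
  qed
qed

lemma classified_semisimple:
  assumes S: "aff2_subalgebra S" and e2: "lin S 0 1 0 z"
  shows "classified S"
proof (cases "\<forall>x1 x2 x3 x4. lin S x1 x2 x3 x4 \<longrightarrow> x1 = 0 \<and> x3 = 0")
  case True
  then show ?thesis using classified_diagonal[OF S e2] by blast
next
  case False
  then obtain x1 x2 x3 x4 where x: "lin S x1 x2 x3 x4" "x1 \<noteq> 0 \<or> x3 \<noteq> 0" by blast
  \<comment> \<open>Bracketing with \<open>e2\<close> deletes the diagonal part and has eigenvalues
    -1 and 1 on \<open>e1\<close> and \<open>e3\<close>; a second bracket separates the two. If only
    \<open>e3\<close> is found, exchanging the axes makes it a multiple of
    \<open>e1\<close>.\<close>
  have a: "lin S (- x1) 0 x3 0" using lin_bracket[OF S e2 x(1)] by simp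
  have b: "lin S x1 0 x3 0" using lin_bracket[OF S e2 a] by simp
  show ?thesis
  proof (cases "x1 = 0")
    case False
    have "lin S 1 0 0 0"
      using lin_scale[OF S lin_diff[OF S b a], of "1 / (2 * x1)"] False by simp
    then show ?thesis by (rule classified_triangular[OF S e2])
  next
    case True
    have e3: "lin S 0 0 (- 1) 0"
      using lin_scale[OF S b, of "- 1 / x3"] True x(2) by simp
    have "lin S 0 (- 1) 0 (- z)" using lin_scale[OF S e2, of "- 1"] by simp
    with e3 show ?thesis
      by (intro swapped(2)[of S], intro classified_triangular[OF swapped(1)[OF S], of "- z"])
        (simp_all add: lin_swapped)
  qed
qed

lemma classified_subalgebra:
  assumes S: "aff2_subalgebra S"
  shows "classified S"
proof (cases "\<exists>x1 x2 x3 x4. lin S x1 x2 x3 x4 \<and> (x1 \<noteq> 0 \<or> x2 \<noteq> 0 \<or> x3 \<noteq> 0)")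
  case False
  then have scalar: "x1 = 0 \<and> x2 = 0 \<and> x3 = 0" if "lin S x1 x2 x3 x4" for x1 x2 x3 x4
    using that by blast
  have 0: "lin S 0 0 0 0" using subalgebra_zero[OF S] by (rule lin_el)
  show ?thesis
  proof (cases "lin S 0 0 0 1")
    case True
    have "lin S x1 x2 x3 x4 \<longleftrightarrow> x1 = 0 \<and> x2 = 0 \<and> x3 = 0" for x1 x2 x3 x4
      using scalar lin_scale[OF S True, of x4] by auto
    then show ?thesis by (rule classified_e4[OF S])
  next
    case False
    have "lin S x1 x2 x3 x4 \<longleftrightarrow> x1 = 0 \<and> x2 = 0 \<and> x3 = 0 \<and> x4 = 0" for x1 x2 x3 x4
      using scalar not_lin_e4[OF S False] 0 by blast
    then show ?thesis by (rule classified_translations[OF S])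
  qed
next
  case nonscalar: True
  show ?thesis
  proof (cases "\<exists>x1 x2 x3 x4. lin S x1 x2 x3 x4 \<and> x2\<^sup>2 - 4 * x1 * x3 \<noteq> 0")
    case True
    then obtain x1 x2 x3 x4 where x: "lin S x1 x2 x3 x4" "x2\<^sup>2 - 4 * x1 * x3 \<noteq> 0" by blast
    from x(2) obtain p q r s t where D: "p * s - q * r \<noteq> 0" and t: "t \<noteq> 0"
      and eqs: "r * s * t = x1 * (p * s - q * r)" "(p * s + q * r) * t = x2 * (p * s - q * r)"
        "p * q * t = x3 * (p * s - q * r)"
      by (rule diagonalize_sl2)
    have "lin (transformed p q r s S) 0 t 0 x4"
      using x(1) D by (simp add: lin_transformed[OF D] eqs)
    from lin_scale[OF transformed(1)[OF D S] this, of "1 / t"]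
    have "lin (transformed p q r s S) 0 1 0 (x4 / t)" using t by simp
    then show ?thesis
      by (intro transformed(2)[OF D, of S]) (rule classified_semisimple[OF transformed(1)[OF D S]])
  next
    case False
    then have nil: "x2\<^sup>2 = 4 * x1 * x3" if "lin S x1 x2 x3 x4" for x1 x2 x3 x4
      using that by auto
    obtain x1 x2 x3 x4 where x: "lin S x1 x2 x3 x4" "x1 \<noteq> 0 \<or> x2 \<noteq> 0 \<or> x3 \<noteq> 0"
      using nonscalar by blast
    from nil[OF x(1)] x(2) obtain p q r s t where D: "p * s - q * r \<noteq> 0" and t: "t \<noteq> 0"
      and eqs: "s\<^sup>2 * t = x1 * (p * s - q * r)" "2 * q * s * t = x2 * (p * s - q * r)"
        "q\<^sup>2 * t = x3 * (p * s - q * r)"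
      by (rule nilpotent_sl2)
    let ?T = "transformed p q r s S"
    have T: "aff2_subalgebra ?T" by (rule transformed(1)[OF D S])
    have "lin ?T t 0 0 x4"
      using x(1) D by (simp add: lin_transformed[OF D] eqs)
    from lin_scale[OF T this, of "1 / t"] have e1: "lin ?T 1 0 0 (x4 / t)" using t by simp
    have "y2\<^sup>2 = 4 * y1 * y3" if y: "lin ?T y1 y2 y3 y4" for y1 y2 y3 y4
    proof -
      let ?z1 = "s\<^sup>2 * y1 + r * s * y2 + r\<^sup>2 * y3"
      let ?z2 = "2 * q * s * y1 + (p * s + q * r) * y2 + 2 * p * r * y3"
      let ?z3 = "q\<^sup>2 * y1 + p * q * y2 + p\<^sup>2 * y3"
      let ?D = "p * s - q * r"
      have "(?z2 / ?D)\<^sup>2 = 4 * (?z1 / ?D) * (?z3 / ?D)"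
        using y unfolding lin_transformed[OF D] by (rule nil)
      then have "?z2\<^sup>2 = 4 * ?z1 * ?z3"
        using D by (simp add: power_divide power2_eq_square[of ?D])
      \<comment> \<open>Invariance of the discriminant under conjugation, before division by the
        determinant.\<close>
      moreover have "?z2\<^sup>2 - 4 * ?z1 * ?z3 = ?D\<^sup>2 * (y2\<^sup>2 - 4 * y1 * y3)" by algebra
      ultimately show ?thesis using D by simp
    qed
    with e1 show ?thesis
      by (intro transformed(2)[OF D, of S]) (rule classified_nilpotent[OF T])
  qed
qed

section \<open>Invariants of the adjoint action\<close>

lemma aff2_equiv_imp_conjugate:
  assumes "aff2_equiv S T"
  obtains g h :: "complex^2^2" and u where "g ** h = mat 1" "h ** g = mat 1"
    "T = (\<lambda>X. (g ** fst X ** h, g *v snd X - (g ** fst X ** h) *v u)) ` S"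
proof -
  obtain g u where "invertible g" "aff2_Ad g u ` S = T"
    using assms unfolding aff2_equiv_def by blast
  then show thesis
    using that[of g "matrix_inv g" u] matrix_inv_mult[of g] by (simp add: aff2_Ad_def[abs_def])
qed

definition has_translation :: "aff2 set \<Rightarrow> bool"
  where "has_translation S \<longleftrightarrow> (\<exists>v. v \<noteq> 0 \<and> (0, v) \<in> S)"

definition has_all_translations :: "aff2 set \<Rightarrow> bool"
  where "has_all_translations S \<longleftrightarrow> (\<forall>v. (0, v) \<in> S)"

definition has_nilpotent :: "aff2 set \<Rightarrow> bool"
  where "has_nilpotent S \<longleftrightarrow> (\<exists>X\<in>S. fst X \<noteq> 0 \<and> trace (fst X) = 0 \<and> det (fst X) = 0)"

definition has_homothety :: "aff2 set \<Rightarrow> bool"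
  where "has_homothety S \<longleftrightarrow> (\<exists>X\<in>S. fst X = mat 1)"

text \<open>The infinitesimal map \<open>x \<mapsto> A x + v\<close> vanishes at \<open>p\<close> up
  to a translation in \<open>S\<close>. Moving \<open>p\<close> to the origin then splits
  \<open>S\<close> into linear maps and translations.\<close>

definition fixes_point :: "aff2 set \<Rightarrow> bool"
  where "fixes_point S \<longleftrightarrow> (\<exists>p. \<forall>X\<in>S. (0, fst X *v p + snd X) \<in> S)"

text \<open>Normalising the discriminant to 1 fixes an element up to sign on a line, so the trace is
  recovered up to sign, exactly the ambiguity left by exchanging the axes.\<close>

definition disc_traces :: "aff2 set \<Rightarrow> complex set"
  where "disc_traces S = {trace (fst X) | X. X \<in> S \<and> (trace (fst X))\<^sup>2 - 4 * det (fst X) = 1}"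

text \<open>The eigenvalue at \<open>v\<close> exceeds the other one by 1. Since \<open>v\<close> tells the two eigenvalues apart,
  the trace is obtained with its sign, which separates \<open>S2_4\<close> from \<open>S2_5\<close>.\<close>

definition eigen_traces :: "aff2 set \<Rightarrow> complex set"
  where "eigen_traces S = {trace (fst X) | X v. X \<in> S \<and> v \<noteq> 0 \<and> (0, v) \<in> S \<and>
    2 *s (fst X *v v) = (trace (fst X) + 1) *s v}"

text \<open>The bracket condition makes \<open>Y\<close> nilpotent and fixes the diagonal of \<open>X\<close>, so that for a Borel
  type linear part the only such trace is the parameter.\<close>

definition borel_traces :: "aff2 set \<Rightarrow> complex set"
  where "borel_traces S = {trace (fst X) | X Y. X \<in> S \<and> Y \<in> S \<and> fst Y \<noteq> 0 \<and>
    fst X ** fst Y - fst Y ** fst X = - fst Y}"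

text \<open>Implications and inclusions suffice, since the equivalence is symmetric.\<close>

lemma
  assumes "aff2_equiv S T"
  shows has_translation_mono: "has_translation S \<Longrightarrow> has_translation T"
    and has_all_translations_mono: "has_all_translations S \<Longrightarrow> has_all_translations T"
    and has_nilpotent_mono: "has_nilpotent S \<Longrightarrow> has_nilpotent T"
    and has_homothety_mono: "has_homothety S \<Longrightarrow> has_homothety T"
    and fixes_point_mono: "fixes_point S \<Longrightarrow> fixes_point T"
    and disc_traces_mono: "disc_traces S \<subseteq> disc_traces T"
    and eigen_traces_mono: "eigen_traces S \<subseteq> eigen_traces T"
    and borel_traces_mono: "borel_traces S \<subseteq> borel_traces T"
proof -
  obtain g h :: "complex^2^2" and u where gh: "g ** h = mat 1" and hg: "h ** g = mat 1"
    and T: "T = (\<lambda>X. (g ** fst X ** h, g *v snd X - (g ** fst X ** h) *v u)) ` S"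
    using assms by (rule aff2_equiv_imp_conjugate)
  have g0: "B ** h ** g = B" for B :: "complex^2^2"
    using hg by (simp add: matrix_mul_assoc[symmetric])
  have gv: "g *v v = 0 \<longleftrightarrow> v = 0" for v
    by (metis hg matrix_vector_mul_assoc matrix_vector_mul_lid matrix_vector_mult_0_right)
  have conj0: "g ** A ** h = 0 \<longleftrightarrow> A = 0" for A
  proof
    assume "g ** A ** h = 0"
    then have "h ** (g ** A ** h) ** g = 0" by simp
    then show "A = 0" by (simp add: matrix_mul_assoc g0 hg)
  qed simp
  have mem: "(g ** A ** h, g *v v - (g ** A ** h) *v u) \<in> T" if "(A, v) \<in> S" for A v
    using that by (force simp: T)
  have mem0: "(0, g *v v) \<in> T" if "(0, v) \<in> S" for v
    using mem[OF that] by simp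
  have tr: "trace (g ** A ** h) = trace A" for A
    by (metis hg matrix_mul_assoc matrix_mul_lid trace_mul_sym)
  have det: "det (g ** A ** h) = det A" for A
  proof -
    have "det g * det h = 1" by (metis det_I det_mul gh)
    then show ?thesis by (simp add: det_mul mult.commute mult.left_commute)
  qed
  show "has_translation S \<Longrightarrow> has_translation T"
    unfolding has_translation_def using mem0 gv by blast
  show "has_all_translations T" if S: "has_all_translations S"
    unfolding has_all_translations_def
  proof
    fix v
    have "(0, g *v (h *v v)) \<in> T" using S mem0 by (auto simp: has_all_translations_def)
    then show "(0, v) \<in> T" by (simp add: matrix_vector_mul_assoc gh)
  qed
  show "has_nilpotent S \<Longrightarrow> has_nilpotent T"
    unfolding has_nilpotent_def T by (auto simp: conj0 tr det)
  show "has_homothety S \<Longrightarrow> has_homothety T"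
    unfolding has_homothety_def T by (force simp: gh)
  show "fixes_point T" if "fixes_point S"
  proof -
    from that obtain p where p: "\<forall>X\<in>S. (0, fst X *v p + snd X) \<in> S"
      unfolding fixes_point_def by blast
    \<comment> \<open>The group element \<open>x \<mapsto> g x + u\<close> carries the fixed point
      \<open>p\<close> to \<open>g p + u\<close>.\<close>
    have "(0, fst Y *v (g *v p + u) + snd Y) \<in> T" if Y: "Y \<in> T" for Y
    proof -
      obtain A v where X: "(A, v) \<in> S" "Y = (g ** A ** h, g *v v - (g ** A ** h) *v u)"
        using Y by (auto simp: T)
      have "fst Y *v (g *v p + u) + snd Y = g *v (A *v p + v)"
        by (simp add: X matrix_vector_right_distrib matrix_vector_mul_assoc matrix_mul_assoc g0)
      then show ?thesis using mem0 p X(1) by force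
    qed
    then show ?thesis unfolding fixes_point_def by blast
  qed
  show "disc_traces S \<subseteq> disc_traces T"
  proof
    fix w assume "w \<in> disc_traces S"
    then obtain A v where "(A, v) \<in> S" "w = trace A" "(trace A)\<^sup>2 - 4 * det A = 1"
      by (auto simp: disc_traces_def)
    then show "w \<in> disc_traces T"
      unfolding disc_traces_def using mem[of A v]
      by (intro CollectI exI[of _ "(g ** A ** h, g *v v - (g ** A ** h) *v u)"])
        (simp add: tr det)
  qed
  show "eigen_traces S \<subseteq> eigen_traces T"
  proof
    fix w assume "w \<in> eigen_traces S"
    then obtain A y v where A: "(A, y) \<in> S" "w = trace A"
      and v: "v \<noteq> 0" "(0, v) \<in> S" "2 *s (A *v v) = (trace A + 1) *s v"
      by (auto simp: eigen_traces_def)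
    have "2 *s ((g ** A ** h) *v (g *v v)) = g *v (2 *s (A *v v))"
      by (simp add: vector_scalar_commute matrix_vector_mul_assoc matrix_mul_assoc g0)
    also have "\<dots> = (trace A + 1) *s (g *v v)"
      by (simp only: v(3) vector_scalar_commute)
    finally show "w \<in> eigen_traces T"
      unfolding eigen_traces_def using mem[OF A(1)] A(2) mem0[OF v(2)] v(1)
      by (intro CollectI exI[of _ "(g ** A ** h, g *v y - (g ** A ** h) *v u)"] exI[of _ "g *v v"])
        (simp add: tr gv)
  qed
  show "borel_traces S \<subseteq> borel_traces T"
  proof
    fix w assume "w \<in> borel_traces S"
    then obtain A v B y where A: "(A, v) \<in> S" "w = trace A"
      and B: "(B, y) \<in> S" "B \<noteq> 0" "A ** B - B ** A = - B"
      by (auto simp: borel_traces_def)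
    have "(g ** A ** h) ** (g ** B ** h) - (g ** B ** h) ** (g ** A ** h)
        = g ** (A ** B - B ** A) ** h"
      by (simp add: matrix_mul_assoc g0 matrix_diff_ldistrib matrix_diff_rdistrib)
    also have "\<dots> = - (g ** B ** h)"
      unfolding B(3) by (simp add: matrix_matrix_mult_def vec_eq_iff sum_negf)
    finally show "w \<in> borel_traces T"
      unfolding borel_traces_def using mem[OF A(1)] mem[OF B(1)] A(2) B(2)
      by (intro CollectI exI[of _ "(g ** A ** h, g *v v - (g ** A ** h) *v u)"]
          exI[of _ "(g ** B ** h, g *v y - (g ** B ** h) *v u)"])
        (simp add: tr conj0)
  qed
qed

lemma dim_equiv:
  assumes "aff2_equiv S T" shows "aff2.dim S = aff2.dim T"
proof -
  interpret P: finite_dimensional_vector_space_pair_1 aff2_scale "{e1, e2, e3, e4, f1, f2}" aff2_scale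
  proof
    show "aff2.independent {e1, e2, e3, e4, f1, f2}"
      by (simp add: aff2.independent_insert mem_span_insert el_simps)
    have "el x1 x2 x3 x4 y1 y2 \<in> aff2.span {e1, e2, e3, e4, f1, f2}" for x1 x2 x3 x4 y1 y2
      by (simp add: mem_span_insert el_simps)
    then show "aff2.span {e1, e2, e3, e4, f1, f2} = UNIV"
      by (metis UNIV_eq_I aff2_exhaust)
  qed simp
  obtain g u where g: "invertible g" and T: "aff2_Ad g u ` S = T"
    using assms unfolding aff2_equiv_def by blast
  have h: "invertible (matrix_inv g)"
    using matrix_inv_mult[OF g] by (auto simp: invertible_def)
  have "inj_on (aff2_Ad g u) (aff2.span S)"
    by (rule inj_on_inverseI[of _ "aff2_Ad (matrix_inv g) (- (matrix_inv g *v u))"])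
      (simp add: aff2_Ad_comp[OF h g] matrix_inv_mult(2)[OF g] aff2_Ad_translation)
  then show ?thesis
    using P.dim_image_eq[OF linear_aff2_Ad, of g u S] T by simp
qed

section \<open>The invariants in coordinates\<close>

lemma fst_el_eq_0: "fst (el x1 x2 x3 x4 y1 y2) = 0 \<longleftrightarrow> x1 = 0 \<and> x2 = 0 \<and> x3 = 0 \<and> x4 = 0"
proof -
  have "fst (el x1 x2 x3 x4 y1 y2) = 0 \<longleftrightarrow> el x1 x2 x3 x4 0 0 = 0"
    by (simp add: el_def prod_eq_iff vec_eq_iff forall_2)
  then show ?thesis by (simp add: el_zero)
qed

lemma trace_fst_el: "trace (fst (el x1 x2 x3 x4 y1 y2)) = x4"
  by (simp add: el_def trace_def sum_2 field_simps)

lemma det_fst_el: "det (fst (el x1 x2 x3 x4 y1 y2)) = (x4\<^sup>2 - x2\<^sup>2) / 4 + x1 * x3"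
  by (simp add: el_def det_2 field_simps power2_eq_square)

lemma translation_el: "(0, vector [y1, y2]) = el 0 0 0 0 y1 y2"
  by (simp add: el_def vec_eq_iff forall_2)

lemma all_complex2: "(\<forall>v :: complex^2. P v) \<longleftrightarrow> (\<forall>y1 y2. P (vector [y1, y2]))"
proof -
  have "v = vector [v $ 1, v $ 2]" for v :: "complex^2" by (simp add: vec_eq_iff forall_2)
  then show ?thesis by metis
qed

lemma ex_complex2: "(\<exists>v :: complex^2. P v) \<longleftrightarrow> (\<exists>y1 y2. P (vector [y1, y2]))"
  using all_complex2[of "\<lambda>v. \<not> P v"] by blast

lemma vector_eq_0: "vector [y1, y2] = (0 :: complex^2) \<longleftrightarrow> y1 = 0 \<and> y2 = 0"
  by (simp add: vec_eq_iff forall_2)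

lemma bex_el: "(\<exists>X\<in>S. P X) \<longleftrightarrow>
   (\<exists>x1 x2 x3 x4 y1 y2. el x1 x2 x3 x4 y1 y2 \<in> S \<and> P (el x1 x2 x3 x4 y1 y2))"
  using all_in_el[of S "\<lambda>X. \<not> P X"] by blast

lemma has_translation_iff:
  "has_translation S \<longleftrightarrow> (\<exists>y1 y2. (y1 \<noteq> 0 \<or> y2 \<noteq> 0) \<and> el 0 0 0 0 y1 y2 \<in> S)"
  by (simp add: has_translation_def ex_complex2 translation_el vector_eq_0)

lemma has_all_translations_iff: "has_all_translations S \<longleftrightarrow> (\<forall>y1 y2. el 0 0 0 0 y1 y2 \<in> S)"
  by (simp add: has_all_translations_def all_complex2 translation_el)

lemma has_nilpotent_iff: "has_nilpotent S \<longleftrightarrow>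
    (\<exists>x1 x2 x3 y1 y2. el x1 x2 x3 0 y1 y2 \<in> S \<and> (x1 \<noteq> 0 \<or> x2 \<noteq> 0 \<or> x3 \<noteq> 0) \<and>
      x2\<^sup>2 = 4 * x1 * x3)"
  unfolding has_nilpotent_def bex_el fst_el_eq_0 trace_fst_el det_fst_el
  by (auto simp: field_simps; metis)

lemma has_homothety_iff: "has_homothety S \<longleftrightarrow> (\<exists>y1 y2. el 0 0 0 2 y1 y2 \<in> S)"
proof -
  have "fst (el x1 x2 x3 x4 y1 y2) = mat 1 \<longleftrightarrow> x1 = 0 \<and> x2 = 0 \<and> x3 = 0 \<and> x4 = 2"
    for x1 x2 x3 x4 y1 y2
  proof -
    have "fst (el x1 x2 x3 x4 y1 y2) = mat 1 \<longleftrightarrow> el x1 x2 x3 x4 0 0 = el 0 0 0 2 0 0"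
      by (simp add: el_def prod_eq_iff vec_eq_iff forall_2 mat_def)
    then show ?thesis by simp
  qed
  then show ?thesis unfolding has_homothety_def bex_el by auto
qed

lemma fixes_point_iff: "fixes_point S \<longleftrightarrow>
    (\<exists>p1 p2. \<forall>x1 x2 x3 x4 y1 y2. el x1 x2 x3 x4 y1 y2 \<in> S \<longrightarrow>
      el 0 0 0 0 ((x2 + x4) / 2 * p1 - x3 * p2 + y1) (x1 * p1 + (x4 - x2) / 2 * p2 + y2) \<in> S)"
proof -
  have "(0, fst (el x1 x2 x3 x4 y1 y2) *v vector [p1, p2] + snd (el x1 x2 x3 x4 y1 y2)) =
      el 0 0 0 0 ((x2 + x4) / 2 * p1 - x3 * p2 + y1) (x1 * p1 + (x4 - x2) / 2 * p2 + y2)"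
    for x1 x2 x3 x4 y1 y2 p1 p2
    by (simp add: el_def vec_eq_iff forall_2 matrix_vector_mult_def sum_2)
  then show ?thesis unfolding fixes_point_def all_in_el ex_complex2 by simp
qed

lemma mem_disc_traces_iff: "w \<in> disc_traces S \<longleftrightarrow>
    (\<exists>x1 x2 x3 y1 y2. el x1 x2 x3 w y1 y2 \<in> S \<and> x2\<^sup>2 - 4 * x1 * x3 = 1)"
proof -
  have "w \<in> disc_traces S \<longleftrightarrow> (\<exists>X\<in>S. w = trace (fst X) \<and> w\<^sup>2 - 4 * det (fst X) = 1)"
    unfolding disc_traces_def by blast
  moreover have "w\<^sup>2 - 4 * ((w\<^sup>2 - x2\<^sup>2) / 4 + x1 * x3) = x2\<^sup>2 - 4 * x1 * x3" for x1 x2 x3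
    by (simp add: field_simps)
  ultimately show ?thesis
    unfolding bex_el trace_fst_el det_fst_el by metis
qed

text \<open>The trace cancels from the eigenvector equation: the two equations say that the
  traceless part has eigenvalue 1/2 at \<open>v\<close>.\<close>

lemma mem_eigen_traces_iff: "w \<in> eigen_traces S \<longleftrightarrow>
    (\<exists>x1 x2 x3 y1 y2 v1 v2. el x1 x2 x3 w y1 y2 \<in> S \<and> (v1 \<noteq> 0 \<or> v2 \<noteq> 0) \<and>
      el 0 0 0 0 v1 v2 \<in> S \<and> (x2 - 1) * v1 = 2 * x3 * v2 \<and> (x2 + 1) * v2 = 2 * x1 * v1)"
proof -
  have *: "w \<in> eigen_traces S \<longleftrightarrow> (\<exists>X\<in>S. \<exists>v. w = trace (fst X) \<and> v \<noteq> 0 \<and> (0, v) \<in> S \<and>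
      2 *s (fst X *v v) = (w + 1) *s v)"
    unfolding eigen_traces_def by blast
  have "2 *s (fst (el x1 x2 x3 w y1 y2) *v vector [v1, v2]) = (w + 1) *s vector [v1, v2] \<longleftrightarrow>
      (x2 - 1) * v1 = 2 * x3 * v2 \<and> (x2 + 1) * v2 = 2 * x1 * v1" for x1 x2 x3 y1 y2 v1 v2
  proof -
    have "2 * ((x2 + w) / 2 * v1 - x3 * v2) - (w + 1) * v1 = (x2 - 1) * v1 - 2 * x3 * v2"
      "2 * (x1 * v1 + (w - x2) / 2 * v2) - (w + 1) * v2 = 2 * x1 * v1 - (x2 + 1) * v2"
      by (simp_all add: field_simps)
    then have "2 * ((x2 + w) / 2 * v1 - x3 * v2) = (w + 1) * v1 \<longleftrightarrow> (x2 - 1) * v1 = 2 * x3 * v2"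
      "2 * (x1 * v1 + (w - x2) / 2 * v2) = (w + 1) * v2 \<longleftrightarrow> (x2 + 1) * v2 = 2 * x1 * v1"
      by (metis eq_iff_diff_eq_0)+
    then show ?thesis
      by (simp only: el_def vec_eq_iff forall_2 matrix_vector_mult_def sum_2 vector_2
          vector_smult_component vec_lambda_beta fst_conv mult_minus_left add_uminus_conv_diff)
  qed
  then show ?thesis
    unfolding * bex_el trace_fst_el ex_complex2 vector_eq_0 translation_el by auto
qed

text \<open>A commutator has trace zero, hence so has \<open>Y\<close>, which explains the
  coordinate 0.\<close>

lemma mem_borel_traces_iff: "w \<in> borel_traces S \<longleftrightarrow>
    (\<exists>x1 x2 x3 y1 y2 x1' x2' x3' y1' y2'. el x1 x2 x3 w y1 y2 \<in> S \<and>
      el x1' x2' x3' 0 y1' y2' \<in> S \<and> (x1' \<noteq> 0 \<or> x2' \<noteq> 0 \<or> x3' \<noteq> 0) \<and>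
      x1 * x2' - x2 * x1' = - x1' \<and> 2 * (x1 * x3' - x3 * x1') = - x2' \<and>
      x2 * x3' - x3 * x2' = - x3')"
proof -
  have *: "w \<in> borel_traces S \<longleftrightarrow> (\<exists>X\<in>S. w = trace (fst X) \<and> (\<exists>Y\<in>S. fst Y \<noteq> 0 \<and>
      fst (aff2_bracket X Y + Y) = 0))"
    unfolding borel_traces_def aff2_bracket_def fst_add fst_conv eq_neg_iff_add_eq_0 by blast
  show ?thesis
    unfolding * bex_el trace_fst_el bracket_el el_add fst_el_eq_0 eq_neg_iff_add_eq_0
    by (auto; blast)
qed

text \<open>The entries tell whether there is a nonzero translation, every translation, a nilpotent
  linear part and a homothety. With the dimension, this table separates all labels except those
  within the groups \<open>S1_2\<close>; \<open>S1_4\<close> to \<open>S1_6\<close>;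
  \<open>S2_2\<close>; \<open>S2_4\<close> to \<open>S2_7\<close>; \<open>S2_10\<close>,
  \<open>S2_11\<close>, \<open>S2_13\<close>; \<open>S3_3\<close>, \<open>S3_4\<close>;
  \<open>S3_7\<close> to \<open>S3_9\<close>; and \<open>S4_3\<close>.\<close>

fun label_type :: "aff2_label \<Rightarrow> bool \<times> bool \<times> bool \<times> bool" where
  "label_type S1_1 = (True, False, False, False)"
| "label_type (S1_2 _) = (False, False, True, False)"
| "label_type S1_3 = (False, False, False, True)"
| "label_type (S1_4 _) = (False, False, False, False)"
| "label_type S1_5 = (False, False, False, False)"
| "label_type S1_6 = (False, False, False, False)"
| "label_type S2_1 = (True, True, False, False)"
| "label_type (S2_2 _) = (True, False, True, False)"
| "label_type S2_3 = (True, False, False, True)"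
| "label_type (S2_4 _) = (True, False, False, False)"
| "label_type (S2_5 _) = (True, False, False, False)"
| "label_type S2_6 = (True, False, False, False)"
| "label_type S2_7 = (True, False, False, False)"
| "label_type S2_8 = (False, False, True, True)"
| "label_type S2_9 = (False, False, False, True)"
| "label_type (S2_10 _) = (False, False, True, False)"
| "label_type (S2_11 _) = (False, False, True, False)"
| "label_type S2_13 = (False, False, True, False)"
| "label_type S3_1 = (True, True, True, False)"
| "label_type S3_2 = (True, True, False, True)"
| "label_type (S3_3 _) = (True, True, False, False)"
| "label_type S3_4 = (True, True, False, False)"
| "label_type S3_5 = (True, False, True, True)"
| "label_type S3_6 = (True, False, False, True)"
| "label_type (S3_7 _) = (True, False, True, False)"
| "label_type S3_8 = (True, False, True, False)"
| "label_type S3_9 = (True, False, True, False)"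
| "label_type S3_10 = (False, False, True, True)"
| "label_type S3_11 = (False, False, True, False)"
| "label_type S4_1 = (True, True, True, True)"
| "label_type S4_2 = (True, True, False, True)"
| "label_type (S4_3 _) = (True, True, True, False)"
| "label_type S4_4 = (True, False, True, True)"
| "label_type S4_5 = (False, False, True, True)"
| "label_type S5_1 = (True, True, True, True)"
| "label_type S5_2 = (True, True, True, False)"

lemma ex_nilpotent:
  "\<exists>x1 x2 x3 :: complex. (x2 = 0 \<longrightarrow> x1 = 0 \<longrightarrow> x3 \<noteq> 0) \<and> x2\<^sup>2 = 4 * x1 * x3"
  by (intro exI[of _ 1] exI[of _ 0]) simp

lemma label_type:
  "label_type L = (has_translation (label_subalgebra L), has_all_translations (label_subalgebra L),
    has_nilpotent (label_subalgebra L), has_homothety (label_subalgebra L))"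
  unfolding has_translation_iff has_all_translations_iff has_nilpotent_iff has_homothety_iff
  by (cases L) (auto simp: label_subalgebra_iff intro: ex_nilpotent exI[of _ 0] exI[of _ 1])

text \<open>\<open>S2_11\<close> appears with parameter 1 only, because with -1 it does fix a point;
  this is the repetition in the list.\<close>

lemma fixes_point_label:
  "fixes_point (label_subalgebra (S1_2 \<delta>)) \<longleftrightarrow> \<delta> = 0"
  "fixes_point (label_subalgebra (S1_4 z))"
  "\<not> fixes_point (label_subalgebra S1_5)"
  "fixes_point (label_subalgebra (S2_2 \<delta>)) \<longleftrightarrow> \<delta> = 0"
  "fixes_point (label_subalgebra (S2_4 z))"
  "fixes_point (label_subalgebra (S2_5 z))"
  "\<not> fixes_point (label_subalgebra S2_6)"
  "fixes_point (label_subalgebra (S2_10 \<gamma>))"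
  "\<not> fixes_point (label_subalgebra (S2_11 1))"
  "\<not> fixes_point (label_subalgebra S2_13)"
  "fixes_point (label_subalgebra (S3_7 \<gamma>))"
  "\<not> fixes_point (label_subalgebra S3_8)"
  "\<not> fixes_point (label_subalgebra S3_9)"
  unfolding fixes_point_iff
  by (auto simp: label_subalgebra_iff intro: exI[of _ 0] exI[of _ 1])
    (rule exI[of _ 0], rule exI[of _ 1], simp, (rule exI[of _ 1], rule exI[of _ 0], simp)+)

text \<open>The empty sets belong to linear parts with vanishing discriminant. \<open>S1_5\<close>
  agrees with \<open>S1_4 1\<close> here; only the fixed point tells them apart.\<close>

lemma disc_traces_label:
  "disc_traces (label_subalgebra (S1_4 z)) = {z, - z}"
  "disc_traces (label_subalgebra S1_5) = {1, - 1}"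
  "disc_traces (label_subalgebra S1_6) = {}"
  "disc_traces (label_subalgebra (S3_3 z)) = {z, - z}"
  "disc_traces (label_subalgebra S3_4) = {}"
  by (auto simp: set_eq_iff mem_disc_traces_iff label_subalgebra_iff power2_eq_1_iff intro: exI[of _ "- 1"])

text \<open>On the line of \<open>f2\<close> the larger eigenvalue is obtained from
  \<open>- e2\<close>, which reverses the sign of \<open>z\<close>. As 0 is excluded from
  \<open>S2_5\<close>, the half plane keeps the values of \<open>S2_4\<close> and
  \<open>S2_5\<close> disjoint.\<close>

lemma eigen_traces_label:
  "eigen_traces (label_subalgebra (S2_4 z)) = {z}"
  "eigen_traces (label_subalgebra (S2_5 z)) = {- z}"
  "eigen_traces (label_subalgebra S2_6) = {1}"
  "eigen_traces (label_subalgebra S2_7) = {}"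
  by (auto simp: set_eq_iff mem_eigen_traces_iff label_subalgebra_iff add_eq_0_iff
      minus_equation_iff[of _ 1] intro: exI[of _ 1] exI[of _ "- 1"])

text \<open>The exceptional algebras share the value of a member of the generic family,
  \<open>S2_13\<close> with \<open>S2_10 (-3)\<close> for example, and differ from it by the missing
  fixed point.\<close>

lemma borel_traces_label:
  "borel_traces (label_subalgebra (S2_10 \<gamma>)) = {\<gamma>}"
  "borel_traces (label_subalgebra (S2_11 \<epsilon>)) = {\<epsilon>}"
  "borel_traces (label_subalgebra S2_13) = {- 3}"
  "borel_traces (label_subalgebra (S3_7 \<gamma>)) = {\<gamma>}"
  "borel_traces (label_subalgebra S3_8) = {- 1}"
  "borel_traces (label_subalgebra S3_9) = {- 3}"
  "borel_traces (label_subalgebra (S4_3 \<gamma>)) = {\<gamma>}"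
  by (auto simp: set_eq_iff mem_borel_traces_iff label_subalgebra_iff)

section \<open>Separation of the labels\<close>

lemma polar_params_doubleton_eq:
  assumes "z \<in> polar_params {0..}" "w \<in> polar_params {0..}" "{z, - z} = {w, - w}"
  shows "z = w"
  using assms polar_params_uminus[of w] by (auto simp: doubleton_eq_iff)

lemma label_eqI:
  assumes "admissible_label L" "admissible_label M"
    and dim: "label_dim L = label_dim M" and type: "label_type L = label_type M"
    and "fixes_point (label_subalgebra L) = fixes_point (label_subalgebra M)"
    and "disc_traces (label_subalgebra L) = disc_traces (label_subalgebra M)"
    and "eigen_traces (label_subalgebra L) = eigen_traces (label_subalgebra M)"
    and "borel_traces (label_subalgebra L) = borel_traces (label_subalgebra M)"
  shows "L = M \<or> {L, M} = {S2_10 (-1), S2_11 (-1)}"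
  using dim type
  by (cases L; cases M; simp)
    (insert assms, simp_all add: fixes_point_label disc_traces_label eigen_traces_label
      borel_traces_label, auto simp: fixes_point_label polar_params_pos insert_commute
      dest: polar_params_doubleton_eq polar_params_uminus)

theorem theorem25:
  shows "(\<forall>L. admissible_label L \<longrightarrow>
            proper_aff2_subalgebra (label_subalgebra L) \<and>
            aff2.dim (label_subalgebra L) = label_dim L) \<and>
         (\<forall>S. proper_aff2_subalgebra S \<longrightarrow>
            (\<exists>L. admissible_label L \<and> aff2_equiv S (label_subalgebra L))) \<and>
         (\<forall>L M. admissible_label L \<and> admissible_label M \<longrightarrow>
            (aff2_equiv (label_subalgebra L) (label_subalgebra M) \<longleftrightarrow>
              L = M \<or> {L, M} = {S2_10 (-1), S2_11 (-1)}))"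
proof (intro conjI allI impI)
  fix S assume "proper_aff2_subalgebra S"
  then show "\<exists>L. admissible_label L \<and> aff2_equiv S (label_subalgebra L)"
    using classified_subalgebra unfolding proper_aff2_subalgebra_def classified_def by blast
next
  fix L M assume LM: "admissible_label L \<and> admissible_label M"
  show "aff2_equiv (label_subalgebra L) (label_subalgebra M) \<longleftrightarrow>
      L = M \<or> {L, M} = {S2_10 (-1), S2_11 (-1)}" (is "?equiv \<longleftrightarrow> ?eq")
  proof
    assume eq: ?equiv
    note eq' = aff2_equiv_sym[OF eq]
    have "label_type L = label_type M"
      unfolding label_type
      using has_translation_mono[OF eq] has_translation_mono[OF eq']
        has_all_translations_mono[OF eq] has_all_translations_mono[OF eq']
        has_nilpotent_mono[OF eq] has_nilpotent_mono[OF eq']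
        has_homothety_mono[OF eq] has_homothety_mono[OF eq'] by blast
    then show ?eq
      using LM dim_equiv[OF eq] fixes_point_mono[OF eq] fixes_point_mono[OF eq']
        equalityI[OF disc_traces_mono[OF eq] disc_traces_mono[OF eq']]
        equalityI[OF eigen_traces_mono[OF eq] eigen_traces_mono[OF eq']]
        equalityI[OF borel_traces_mono[OF eq] borel_traces_mono[OF eq']]
      by (intro label_eqI) (auto simp: dim_label)
  next
    assume ?eq
    then show ?equiv
      using label_subalgebra_repetition aff2_equiv_refl aff2_equiv_sym
      by (auto simp: doubleton_eq_iff)
  qed
qed (simp_all add: proper_label dim_label)

end
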